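(* Let $S$ be an infinite dimensional separable Banach space and $Y$ a nonseparable Banach space. Let $X=S\oplus_{\ell_1}Y$. Then there exists a weak$^\ast$-to-weak$^\ast$ homeomorphism $f:B_{X^\ast}\to B_{X^\ast}$ which is not norm-to-norm continuous.
   Context: $B_{X^\ast}$ denotes the closed unit ball of the dual space $X^\ast$. $S\oplus_{\ell_1}Y$ is the direct sum with norm $\|s\|+\|y\|$. *)

theory Defs
  imports "HOL-Analysis.Analysis"
begin

text \<open>
  The library norm on \<open>'a \<times> 'b\<close> is the Euclidean combination of the two norms, so the
  \<open>\<ell>\<^sub>1\<close>-sum needs a type of its own.
\<close>

datatype ('a, 'b) l1_sum = L1_Pair (l1_fst: 'a) (l1_snd: 'b)

lemma l1_sum_eq_iff: "x = y \<longleftrightarrow> l1_fst x = l1_fst y \<and> l1_snd x = l1_snd y"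
  by (cases x; cases y) auto

instantiation l1_sum :: (real_vector, real_vector) real_vector
begin

definition zero_l1_sum :: "('a, 'b) l1_sum"
  where "0 = L1_Pair 0 0"

definition plus_l1_sum :: "('a, 'b) l1_sum \<Rightarrow> ('a, 'b) l1_sum \<Rightarrow> ('a, 'b) l1_sum"
  where "x + y = L1_Pair (l1_fst x + l1_fst y) (l1_snd x + l1_snd y)"

definition minus_l1_sum :: "('a, 'b) l1_sum \<Rightarrow> ('a, 'b) l1_sum \<Rightarrow> ('a, 'b) l1_sum"
  where "x - y = L1_Pair (l1_fst x - l1_fst y) (l1_snd x - l1_snd y)"

definition uminus_l1_sum :: "('a, 'b) l1_sum \<Rightarrow> ('a, 'b) l1_sum"
  where "- x = L1_Pair (- l1_fst x) (- l1_snd x)"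

definition scaleR_l1_sum :: "real \<Rightarrow> ('a, 'b) l1_sum \<Rightarrow> ('a, 'b) l1_sum"
  where "r *\<^sub>R x = L1_Pair (r *\<^sub>R l1_fst x) (r *\<^sub>R l1_snd x)"

instance
  by standard
    (simp_all add: l1_sum_eq_iff zero_l1_sum_def plus_l1_sum_def minus_l1_sum_def
      uminus_l1_sum_def scaleR_l1_sum_def algebra_simps)

end

lemma l1_fst_simps [simp]:
  "l1_fst 0 = 0" "l1_fst (x + y) = l1_fst x + l1_fst y" "l1_fst (x - y) = l1_fst x - l1_fst y"
  "l1_fst (- x) = - l1_fst x" "l1_fst (r *\<^sub>R x) = r *\<^sub>R l1_fst x"
  by (simp_all add: zero_l1_sum_def plus_l1_sum_def minus_l1_sum_def uminus_l1_sum_def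
      scaleR_l1_sum_def)

lemma l1_snd_simps [simp]:
  "l1_snd 0 = 0" "l1_snd (x + y) = l1_snd x + l1_snd y" "l1_snd (x - y) = l1_snd x - l1_snd y"
  "l1_snd (- x) = - l1_snd x" "l1_snd (r *\<^sub>R x) = r *\<^sub>R l1_snd x"
  by (simp_all add: zero_l1_sum_def plus_l1_sum_def minus_l1_sum_def uminus_l1_sum_def
      scaleR_l1_sum_def)

instantiation l1_sum :: (real_normed_vector, real_normed_vector) real_normed_vector
begin

definition norm_l1_sum :: "('a, 'b) l1_sum \<Rightarrow> real"
  where "norm_l1_sum x = norm (l1_fst x) + norm (l1_snd x)"

definition dist_l1_sum :: "('a, 'b) l1_sum \<Rightarrow> ('a, 'b) l1_sum \<Rightarrow> real"
  where "dist_l1_sum x y = norm (x - y)"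

definition sgn_l1_sum :: "('a, 'b) l1_sum \<Rightarrow> ('a, 'b) l1_sum"
  where "sgn_l1_sum x = x /\<^sub>R norm x"

definition uniformity_l1_sum :: "(('a, 'b) l1_sum \<times> ('a, 'b) l1_sum) filter"
  where "uniformity_l1_sum = (INF e\<in>{0<..}. principal {(x :: ('a, 'b) l1_sum, y). dist x y < e})"

definition open_l1_sum :: "('a, 'b) l1_sum set \<Rightarrow> bool"
  where "open_l1_sum U \<longleftrightarrow> (\<forall>x\<in>U. \<forall>\<^sub>F (x', y) in uniformity. x' = x \<longrightarrow> y \<in> U)"

instance
proof
  fix x y :: "('a, 'b) l1_sum" and r :: real
  show "norm x = 0 \<longleftrightarrow> x = 0"
    by (simp add: norm_l1_sum_def l1_sum_eq_iff add_nonneg_eq_0_iff)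
  show "norm (x + y) \<le> norm x + norm y"
    using norm_triangle_ineq[of "l1_fst x" "l1_fst y"] norm_triangle_ineq[of "l1_snd x" "l1_snd y"]
    by (simp add: norm_l1_sum_def)
  show "norm (r *\<^sub>R x) = \<bar>r\<bar> * norm x"
    by (simp add: norm_l1_sum_def algebra_simps)
qed (rule dist_l1_sum_def sgn_l1_sum_def uniformity_l1_sum_def open_l1_sum_def)+

end

instance l1_sum :: (banach, banach) banach
proof
  fix X :: "nat \<Rightarrow> ('a, 'b) l1_sum"
  assume X: "Cauchy X"
  have "dist (l1_fst x) (l1_fst y) \<le> dist x y" "dist (l1_snd x) (l1_snd y) \<le> dist x y"
    for x y :: "('a, 'b) l1_sum"
    by (simp_all add: dist_norm norm_l1_sum_def)
  then have "Cauchy (\<lambda>n. l1_fst (X n))" "Cauchy (\<lambda>n. l1_snd (X n))"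
    using X unfolding Cauchy_def by (meson order_le_less_trans)+
  then obtain a b where a: "(\<lambda>n. l1_fst (X n)) \<longlonglongrightarrow> a" and b: "(\<lambda>n. l1_snd (X n)) \<longlonglongrightarrow> b"
    by (meson Cauchy_convergent convergent_def)
  have "(\<lambda>n. norm (l1_fst (X n) - a) + norm (l1_snd (X n) - b)) \<longlonglongrightarrow> 0"
    using tendsto_add[OF tendsto_norm_zero[OF LIM_zero[OF a]] tendsto_norm_zero[OF LIM_zero[OF b]]]
    by simp
  then have "(\<lambda>n. norm (X n - L1_Pair a b)) \<longlonglongrightarrow> 0"
    by (simp add: norm_l1_sum_def)
  then show "convergent X"
    by (rule convergentI[OF LIM_zero_cancel[OF tendsto_norm_zero_cancel]])
qed

text \<open>
  For real-valued functionals the strong operator topology, i.e. the topology of pointwise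
  convergence, is the weak-star topology of the dual \<open>'a \<Rightarrow>\<^sub>L real\<close>.
\<close>

abbreviation weak_star_topology :: "('a::real_normed_vector \<Rightarrow>\<^sub>L real) topology"
  where "weak_star_topology \<equiv> strong_operator_topology"

abbreviation weak_star_ball :: "('a::real_normed_vector \<Rightarrow>\<^sub>L real) topology"
  where "weak_star_ball \<equiv> subtopology weak_star_topology (cball 0 1)"

end

theory Submission
  imports Defs
begin

text \<open>
  Since \<open>B\<^bsub>X*\<^esub> = B\<^bsub>S*\<^esub> \<times> B\<^bsub>Y*\<^esub>\<close>, it is enough to find a weak-star homeomorphism of
  \<open>B\<^bsub>S*\<^esub>\<close> that is not norm continuous. Choose unit vectors \<open>x\<^sub>0, x\<^sub>1, \<dots>\<close> that separate the points
  of \<open>S*\<close>, none of them in the closed span of its predecessors, and identify \<open>B\<^bsub>S*\<^esub>\<close> with the compact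
  convex set \<open>K\<close> of sequences \<open>(s x\<^sub>n)\<close>.
  As in Keller's theorem on infinite-dimensional compact convex sets, \<open>K\<close> is first made strictly convex:
  it is homeomorphic to \<open>C = {t. \<parallel>t\<parallel> + Q t \<le> 1}\<close>, where \<open>\<parallel>\<cdot>\<parallel>\<close> is the gauge of \<open>K\<close> and
  \<open>Q t = \<Sum>\<^sub>n 2\<^sup>-\<^sup>n\<^sup>-\<^sup>2 t\<^sub>n\<^sup>2\<close>. In a strictly convex body, the interval of values of the \<open>n\<close>-th coordinate
  depends continuously on the coordinates before it, so that a point is described by its relative
  positions \<open>\<theta>\<^sub>n \<in> [-1, 1]\<close> in these intervals. The map \<open>\<theta>\<^sub>n \<mapsto> root (2n + 1) \<theta>\<^sub>n\<close> is then well
  defined and a homeomorphism of \<open>C\<close>. It fixes 0, but it sends points with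
  \<open>\<theta>\<^sub>n = (3/4)\<^sup>2\<^sup>n\<^sup>+\<^sup>1\<close>, which tend to 0 in norm, to points with \<open>\<theta>\<^sub>n = 3/4\<close>, which stay away from 0.
\<close>

subsection \<open>A strictly convex quadratic form on sequences\<close>

text \<open>The weights start at 1/4 so that they sum to 1/2. Hence
  \<open>1 - wsq t \<ge> 1/2\<close> on the cube, which makes all later divisions by this quantity
  safe.\<close>

definition wsq :: "(nat \<Rightarrow> real) \<Rightarrow> real"
  where "wsq t = (\<Sum>n. (1/2) ^ (n + 2) * (t n)\<^sup>2)"

lemma sums_wsq_weights: "(\<lambda>n. (1/2::real) ^ (n + 2)) sums (1/2)"
  using sums_mult[OF geometric_sums[of "1/2::real"], of "1/4"] by (simp add: power2_eq_square)

lemma summable_wsq: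
  assumes "\<And>n. \<bar>t n\<bar> \<le> 1"
  shows "summable (\<lambda>n. (1/2::real) ^ (n + 2) * (t n)\<^sup>2)"
proof (rule summable_comparison_test')
  show "summable (\<lambda>n. (1/2::real) ^ (n + 2))"
    using sums_wsq_weights by (rule sums_summable)
  show "norm ((1/2::real) ^ (n + 2) * (t n)\<^sup>2) \<le> (1/2) ^ (n + 2)" for n
    using assms[of n] abs_square_le_1[of "t n"] by (simp add: abs_mult mult_left_le)
qed

lemma sums_wsq:
  assumes "\<And>n. \<bar>t n\<bar> \<le> 1"
  shows "(\<lambda>n. (1/2::real) ^ (n + 2) * (t n)\<^sup>2) sums wsq t"
  unfolding wsq_def using summable_wsq[OF assms] by (rule summable_sums)

lemma wsq_eqI: "(\<lambda>n. (1/2) ^ (n + 2) * (t n)\<^sup>2) sums s \<Longrightarrow> wsq t = s"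
  unfolding wsq_def by (rule sums_unique[symmetric])

lemma wsq_nonneg: "(\<And>n. \<bar>t n\<bar> \<le> 1) \<Longrightarrow> 0 \<le> wsq t"
  unfolding wsq_def by (intro suminf_nonneg summable_wsq) auto

lemma wsq_pos:
  assumes "\<And>n. \<bar>t n\<bar> \<le> 1" and "t k \<noteq> 0"
  shows "0 < wsq t"
  unfolding wsq_def
  by (rule suminf_pos2[OF summable_wsq, where i = k]) (use assms in auto)

lemma wsq_le:
  assumes "\<And>n. \<bar>t n\<bar> \<le> 1"
  shows "wsq t \<le> 1/2"
proof (rule sums_le[OF _ sums_wsq[OF assms] sums_wsq_weights])
  show "(1/2::real) ^ (n + 2) * (t n)\<^sup>2 \<le> (1/2) ^ (n + 2)" for n
    using assms[of n] abs_square_le_1[of "t n"] by (simp add: mult_left_le)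
qed

lemma wsq_scale:
  assumes "\<And>n. \<bar>t n\<bar> \<le> 1"
  shows "wsq (\<lambda>n. a * t n) = a\<^sup>2 * wsq t"
  using sums_mult[OF sums_wsq[OF assms], of "a\<^sup>2"]
  by (simp add: wsq_def sums_iff algebra_simps power_mult_distrib)

text \<open>Coordinatewise this is \<open>((1-c)a + cb)^2 = (1-c)a^2 + cb^2 - c(1-c)(a-b)^2\<close>.
  The difference is halved to stay in the cube, where the series converges. The defect term is the
  source of strict convexity.\<close>

lemma wsq_mix:
  assumes u: "\<And>n. \<bar>u n\<bar> \<le> 1" and v: "\<And>n. \<bar>v n\<bar> \<le> 1"
  shows "wsq (\<lambda>n. (1 - c) * u n + c * v n) =
    (1 - c) * wsq u + c * wsq v - 4 * c * (1 - c) * wsq (\<lambda>n. (u n - v n) / 2)"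
proof -
  have d: "\<bar>(u n - v n) / 2\<bar> \<le> 1" for n
    using u[of n] v[of n] by (simp add: abs_le_iff)
  have "(\<lambda>n. (1 - c) * ((1/2) ^ (n + 2) * (u n)\<^sup>2) + c * ((1/2) ^ (n + 2) * (v n)\<^sup>2)
       - 4 * c * (1 - c) * ((1/2) ^ (n + 2) * ((u n - v n) / 2)\<^sup>2)) sums
    ((1 - c) * wsq u + c * wsq v - 4 * c * (1 - c) * wsq (\<lambda>n. (u n - v n) / 2))"
    by (intro sums_add sums_diff sums_mult sums_wsq u v d)
  moreover have "(1 - c) * ((1/2) ^ (n + 2) * (u n)\<^sup>2) + c * ((1/2) ^ (n + 2) * (v n)\<^sup>2)
       - 4 * c * (1 - c) * ((1/2) ^ (n + 2) * ((u n - v n) / 2)\<^sup>2)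
      = (1/2) ^ (n + 2) * ((1 - c) * u n + c * v n)\<^sup>2" for n
  proof -
    define p :: real where "p = (1/2) ^ (n + 2)"
    show ?thesis unfolding p_def[symmetric] by (simp add: power2_eq_square field_simps)
  qed
  ultimately show ?thesis
    by (intro wsq_eqI) (simp only:)
qed

text \<open>For \<open>0 \<le> c \<le> 1\<close> the terms \<open>2cuv\<close> and
  \<open>c^2 v^2\<close> add at most \<open>3c\<close> to each square, and the weights sum to
  1/2.\<close>

lemma wsq_perturb:
  assumes u: "\<And>n. \<bar>u n\<bar> \<le> 1" and v: "\<And>n. \<bar>v n\<bar> \<le> 1" and uv: "\<And>n. \<bar>u n + c * v n\<bar> \<le> 1"
    and c: "0 \<le> c" "c \<le> 1"
  shows "wsq (\<lambda>n. u n + c * v n) \<le> wsq u + 3/2 * c"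
proof -
  have "(\<lambda>n. (1/2) ^ (n + 2) * (u n)\<^sup>2 + 3 * c * (1/2) ^ (n + 2)) sums (wsq u + 3 * c * (1/2))"
    by (intro sums_add sums_mult sums_wsq u sums_wsq_weights)
  moreover have "(1/2) ^ (n + 2) * (u n + c * v n)\<^sup>2 \<le> (1/2) ^ (n + 2) * (u n)\<^sup>2 + 3 * c * (1/2) ^ (n + 2)" for n
  proof -
    have "\<bar>u n * v n\<bar> \<le> 1" "(v n)\<^sup>2 \<le> 1"
      using u[of n] v[of n] by (auto simp: abs_mult mult_le_one abs_square_le_1)
    then have "c * (u n * v n) \<le> c" "c\<^sup>2 * (v n)\<^sup>2 \<le> c * 1"
      using c mult_left_le_one_le[of c c]
      by (auto simp: power2_eq_square simp del: mult_1_right intro!: mult_left_le mult_mono)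
    then have "(u n + c * v n)\<^sup>2 \<le> (u n)\<^sup>2 + 3 * c"
      by (simp add: power2_eq_square algebra_simps)
    from mult_left_mono[OF this, of "(1/2) ^ (n + 2)"] show ?thesis
      by (simp add: algebra_simps)
  qed
  ultimately have "wsq (\<lambda>n. u n + c * v n) \<le> wsq u + 3 * c * (1/2)"
    by (rule sums_le[OF _ sums_wsq[of "\<lambda>n. u n + c * v n", OF uv], rotated])
  then show ?thesis
    by simp
qed

definition cube :: "(nat \<Rightarrow> real) set"
  where "cube = {t. \<forall>n. \<bar>t n\<bar> \<le> 1}"

lemma cubeD: "t \<in> cube \<Longrightarrow> \<bar>t n\<bar> \<le> 1"
  by (simp add: cube_def)

lemma compact_cube: "compact cube"
proof -
  have "compactin (product_topology (\<lambda>_. euclidean) UNIV) (PiE UNIV (\<lambda>_::nat. {-1..1::real}))"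
    by (simp add: compactin_PiE)
  moreover have "PiE UNIV (\<lambda>_. {-1..1}) = cube"
    by (auto simp: cube_def PiE_def abs_le_iff minus_le_iff)
  ultimately show ?thesis
    by (simp add: euclidean_product_topology)
qed

lemma continuous_on_coordinate: "continuous_on S (\<lambda>t :: 'a \<Rightarrow> 'b::topological_space. t i)"
  by (rule continuous_on_product_then_coordinatewise) (rule continuous_on_id)

lemma continuous_on_wsq: "continuous_on cube wsq"
proof -
  have "uniform_limit cube (\<lambda>m t. \<Sum>n<m. (1/2) ^ (n + 2) * (t n)\<^sup>2) wsq sequentially"
    unfolding wsq_def
  proof (rule Weierstrass_m_test)
    show "norm ((1/2::real) ^ (n + 2) * (t n)\<^sup>2) \<le> (1/2) ^ (n + 2)" if "t \<in> cube" for n t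
      using cubeD[OF that, of n] abs_square_le_1[of "t n"] by (simp add: abs_mult mult_left_le)
    show "summable (\<lambda>n. (1/2::real) ^ (n + 2))"
      using sums_wsq_weights by (rule sums_summable)
  qed
  moreover have "continuous_on cube (\<lambda>t. \<Sum>n<m. (1/2) ^ (n + 2) * (t n)\<^sup>2)" for m
    by (intro continuous_intros continuous_on_coordinate)
  ultimately show ?thesis
    by (intro uniform_limit_theorem[where F = sequentially]) auto
qed

text \<open>Each projection is a continuous bijection from a compact space to a Hausdorff space,
  hence a homeomorphism; \<open>f\<close> is the inverse of the first followed by the second.
  Continuity thus needs no formula for the map.\<close>

lemma homeomorphism_of_compact_graph:
  fixes R :: "('a::t2_space \<times> 'b::t2_space) set"
  assumes R: "compact R" and "inj_on fst R" "inj_on snd R" "fst ` R = X" "snd ` R = Y"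
  shows "\<exists>f g. homeomorphism X Y f g \<and> (\<forall>x\<in>X. (x, f x) \<in> R)"
proof -
  obtain p q where p: "homeomorphism R X fst p" and q: "homeomorphism R Y snd q"
    using homeomorphism_compact[OF R _ \<open>fst ` R = X\<close> \<open>inj_on fst R\<close>]
      homeomorphism_compact[OF R _ \<open>snd ` R = Y\<close> \<open>inj_on snd R\<close>]
      continuous_on_fst[OF continuous_on_id] continuous_on_snd[OF continuous_on_id] by blast
  have "homeomorphism X Y (snd \<circ> p) (fst \<circ> q)"
    using homeomorphism_compose[OF homeomorphism_symD[OF p] q] .
  moreover have "(x, (snd \<circ> p) x) \<in> R" if "x \<in> X" for x
  proof -
    have "p x \<in> R" "fst (p x) = x"
      using p that by (auto simp: homeomorphism_def)
    then show ?thesis by (cases "p x") auto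
  qed
  ultimately show ?thesis by blast
qed

subsection \<open>Strictly convex sequence bodies\<close>

text \<open>\<open>K\<close> stands for the dual ball seen through countably many evaluations.
  \<open>K_basis\<close> encodes infinite dimension: no coordinate is determined on \<open>K\<close>
  by its predecessors.\<close>

locale sequence_body =
  fixes K :: "(nat \<Rightarrow> real) set"
  assumes compact_K: "compact K"
    and K_cube: "K \<subseteq> cube"
    and K_absconvex: "\<And>u v a b. u \<in> K \<Longrightarrow> v \<in> K \<Longrightarrow> \<bar>a\<bar> + \<bar>b\<bar> \<le> 1 \<Longrightarrow> (\<lambda>n. a * u n + b * v n) \<in> K"
    and K_basis: "\<And>n. \<exists>e\<in>K. (\<forall>j<n. e j = 0) \<and> 0 < e n"
begin

text \<open>As \<open>wsq \<le> 1/2\<close> on the cube, \<open>t / (1 - wsq t) \<in> K\<close> says \<open>\<parallel>t\<parallel> + wsq t \<le> 1\<close> for the gauge of \<open>K\<close>.\<close>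

definition C :: "(nat \<Rightarrow> real) set"
  where "C = {t \<in> cube. (\<lambda>n. t n / (1 - wsq t)) \<in> K}"

lemma K_scale: "u \<in> K \<Longrightarrow> \<bar>a\<bar> \<le> 1 \<Longrightarrow> (\<lambda>n. a * u n) \<in> K"
  using K_absconvex[of u u a 0] by simp

lemma C_cube: "t \<in> C \<Longrightarrow> t \<in> cube"
  by (simp add: C_def)

lemma wsq_cube_le: "t \<in> cube \<Longrightarrow> wsq t \<le> 1/2"
  by (rule wsq_le) (rule cubeD)

lemma wsq_cube_nonneg: "t \<in> cube \<Longrightarrow> 0 \<le> wsq t"
  by (rule wsq_nonneg) (rule cubeD)

lemma K_cone:
  assumes u: "u \<in> K" and v: "v \<in> K" and "0 \<le> a" "0 \<le> b" "0 < a + b"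
  obtains c where "c \<in> K" "(\<lambda>n. a * u n + b * v n) = (\<lambda>n. (a + b) * c n)"
proof (rule that)
  have "\<bar>a / (a + b)\<bar> + \<bar>b / (a + b)\<bar> = 1"
    using assms by (simp add: add_divide_distrib[symmetric])
  then show "(\<lambda>n. a / (a + b) * u n + b / (a + b) * v n) \<in> K"
    by (intro K_absconvex u v) simp
  show "(\<lambda>n. a * u n + b * v n) = (\<lambda>n. (a + b) * (a / (a + b) * u n + b / (a + b) * v n))"
    using assms by (simp add: distrib_left)
qed

text \<open>A bound \<open>r\<close> for the gauge of \<open>t\<close> suffices. Membership in the
  cube comes for free: \<open>wsq t = r^2 wsq c \<ge> 0\<close> forces
  \<open>r \<le> 1\<close>.\<close>

lemma C_I:
  assumes c: "c \<in> K" and r: "0 \<le> r" "r \<le> 1 - wsq t" and t: "\<And>n. t n = r * c n"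
  shows "t \<in> C"
proof -
  have teq: "t = (\<lambda>n. r * c n)"
    using t by auto
  have ccube: "\<bar>c n\<bar> \<le> 1" for n
    using c K_cube cubeD by blast
  have "0 \<le> r\<^sup>2 * wsq c"
    using wsq_nonneg[of c, OF ccube] by simp
  then have "r \<le> 1"
    using r wsq_scale[of c r, OF ccube] by (simp add: teq)
  then have "\<bar>r * c n\<bar> \<le> 1" for n
    using r ccube[of n] by (simp add: abs_mult mult_le_one)
  then have tc: "t \<in> cube"
    by (simp add: teq cube_def)
  then have "1 - wsq t > 0"
    using wsq_cube_le[OF tc] by simp
  then have "\<bar>r / (1 - wsq t)\<bar> \<le> 1"
    using r by simp
  from K_scale[OF c this] show ?thesis
    using tc by (simp add: C_def t)
qed

lemma C_E:
  assumes "t \<in> C"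
  obtains c where "c \<in> K" "t = (\<lambda>n. (1 - wsq t) * c n)"
proof (rule that)
  show "(\<lambda>n. t n / (1 - wsq t)) \<in> K"
    using assms by (simp add: C_def)
  show "t = (\<lambda>n. (1 - wsq t) * (t n / (1 - wsq t)))"
    using wsq_cube_le[OF C_cube[OF assms]] by (auto simp: fun_eq_iff)
qed

lemma C_subset_K:
  assumes "t \<in> C"
  shows "t \<in> K"
proof -
  obtain c where c: "c \<in> K" "t = (\<lambda>n. (1 - wsq t) * c n)"
    using C_E[OF assms] .
  have "\<bar>1 - wsq t\<bar> \<le> 1"
    using wsq_cube_le[OF C_cube[OF assms]] wsq_cube_nonneg[OF C_cube[OF assms]] by simp
  from K_scale[OF c(1) this] show ?thesis
    using c(2) by simp
qed

text \<open>Interior points with respect to the gauge of \<open>K\<close>; \<open>C\<close> has no interior in the product topology.\<close>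

definition strict :: "(nat \<Rightarrow> real) \<Rightarrow> bool"
  where "strict w \<longleftrightarrow> (\<exists>\<delta>>0. \<forall>e\<in>K. (\<lambda>n. w n + \<delta> * e n) \<in> C)"

lemma strictI:
  assumes c: "c \<in> K" and r: "0 \<le> r" "r < 1 - wsq w" and weq: "\<And>n. w n = r * c n"
  shows "strict w"
proof -
  \<comment> \<open>A third of the slack: moving by \<open>\<delta> * e\<close> raises the gauge by
    at most \<open>\<delta>\<close> and \<open>wsq\<close> by at most \<open>3/2 * \<delta>\<close>,
    in total less than \<open>3 * \<delta>\<close>.\<close>
  define \<delta> where "\<delta> = (1 - wsq w - r) / 3"
  have w: "w \<in> C"
    using C_I[of c r w] c r weq by simp
  have "r + 3 * \<delta> = 1 - wsq w"
    using nonzero_mult_div_cancel_left[of 3 "1 - wsq w - r"] by (simp only: \<delta>_def times_divide_eq_right)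
  moreover from this have "\<delta> > 0"
    using r by linarith
  moreover have "0 \<le> wsq w"
    using wsq_cube_nonneg[OF C_cube[OF w]] .
  ultimately have \<delta>: "\<delta> > 0" "r + 3 * \<delta> = 1 - wsq w" "\<delta> \<le> 1" "r + \<delta> \<le> 1" "0 < r + \<delta>"
    using r(1) by auto
  have "(\<lambda>n. w n + \<delta> * e n) \<in> C" if e: "e \<in> K" for e
  proof -
    obtain f where f: "f \<in> K" and eq': "(\<lambda>n. r * c n + \<delta> * e n) = (\<lambda>n. (r + \<delta>) * f n)"
      using K_cone[OF c e r(1) less_imp_le[OF \<delta>(1)] \<delta>(5)] .
    note eq = fun_cong[OF eq']
    have "\<bar>f n\<bar> \<le> 1" for n
      using f K_cube cubeD by blast
    then have "\<bar>(r + \<delta>) * f n\<bar> \<le> 1" for n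
      using r \<delta> by (simp add: abs_mult mult_le_one)
    then have b: "\<bar>w n + \<delta> * e n\<bar> \<le> 1" for n
      by (simp only: weq eq)
    have "\<bar>w n\<bar> \<le> 1" "\<bar>e n\<bar> \<le> 1" for n
      using cubeD[OF C_cube[OF w]] e K_cube cubeD by blast+
    then have "wsq (\<lambda>n. w n + \<delta> * e n) \<le> wsq w + 3/2 * \<delta>"
      using b \<delta> by (intro wsq_perturb) auto
    then have "r + \<delta> \<le> 1 - wsq (\<lambda>n. w n + \<delta> * e n)"
      using \<delta> by linarith
    then show ?thesis
      using r \<delta> weq eq by (intro C_I[OF f, of "r + \<delta>"]) simp_all
  qed
  then show ?thesis
    unfolding strict_def using \<delta> by blast
qed

text \<open>The gauge is convex, and by \<open>wsq_mix\<close> the mixture gains the slack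
  \<open>4a(1-a) wsq((u-v)/2)\<close>. It is positive for a proper mixture of distinct points, so
  \<open>strictI\<close> applies.\<close>

lemma C_mix:
  assumes u: "u \<in> C" and v: "v \<in> C" and a: "0 \<le> a" "a \<le> 1"
  shows "(\<lambda>n. (1 - a) * u n + a * v n) \<in> C"
    and "0 < a \<Longrightarrow> a < 1 \<Longrightarrow> u k \<noteq> v k \<Longrightarrow> strict (\<lambda>n. (1 - a) * u n + a * v n)"
proof -
  obtain u0 v0 where u0: "u0 \<in> K" "u = (\<lambda>n. (1 - wsq u) * u0 n)" and v0: "v0 \<in> K" "v = (\<lambda>n. (1 - wsq v) * v0 n)"
    using u v C_E by metis
  define w where "w = (\<lambda>n. (1 - a) * u n + a * v n)"
  define \<alpha> \<beta> where "\<alpha> = (1 - a) * (1 - wsq u)" and "\<beta> = a * (1 - wsq v)"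
  define d where "d = wsq (\<lambda>n. (u n - v n) / 2)"
  have ub: "\<And>n. \<bar>u n\<bar> \<le> 1" and vb: "\<And>n. \<bar>v n\<bar> \<le> 1"
    using u v C_cube cubeD by blast+
  have db: "\<bar>(u n - v n) / 2\<bar> \<le> 1" for n
    using ub[of n] vb[of n] by (simp add: abs_le_iff)
  have le: "1/2 \<le> 1 - wsq u" "1/2 \<le> 1 - wsq v"
    using wsq_cube_le[OF C_cube[OF u]] wsq_cube_le[OF C_cube[OF v]] by linarith+
  then have nonneg: "0 \<le> \<alpha>" "0 \<le> \<beta>"
    using a by (auto simp: \<alpha>_def \<beta>_def)
  have pos: "0 < \<alpha> + \<beta>"
  proof -
    have "(1 - a) * (1/2) + a * (1/2) \<le> \<alpha> + \<beta>"
      unfolding \<alpha>_def \<beta>_def using a le by (intro add_mono mult_left_mono) auto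
    then show ?thesis by (simp add: field_simps)
  qed
  have sum: "\<alpha> + \<beta> = 1 - wsq w - 4 * a * (1 - a) * d"
    unfolding w_def wsq_mix[OF ub vb] \<alpha>_def \<beta>_def d_def by (simp add: algebra_simps)
  obtain c where c: "c \<in> K" and eq': "(\<lambda>n. \<alpha> * u0 n + \<beta> * v0 n) = (\<lambda>n. (\<alpha> + \<beta>) * c n)"
    by (rule K_cone[OF u0(1) v0(1) nonneg pos])
  note eq = fun_cong[OF eq']
  have w: "w n = (\<alpha> + \<beta>) * c n" for n
    unfolding eq[symmetric] unfolding w_def \<alpha>_def \<beta>_def
    by (subst fun_cong[OF u0(2), of n], subst fun_cong[OF v0(2), of n]) simp
  have "0 \<le> 4 * a * (1 - a) * d"
    using a wsq_nonneg[OF db] by (simp add: d_def)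
  then show "(\<lambda>n. (1 - a) * u n + a * v n) \<in> C"
    unfolding w_def[symmetric] using sum pos by (intro C_I[OF c _ _ w]) linarith+
  assume "0 < a" "a < 1" "u k \<noteq> v k"
  then have "0 < 4 * a * (1 - a) * d"
    unfolding d_def using wsq_pos[OF db, where k = k] by simp
  then show "strict (\<lambda>n. (1 - a) * u n + a * v n)"
    unfolding w_def[symmetric] using sum pos by (intro strictI[OF c _ _ w]) linarith+
qed

lemma wsq_uminus [simp]: "wsq (\<lambda>n. - t n) = wsq t"
  by (simp add: wsq_def)

lemma C_uminus: "t \<in> C \<Longrightarrow> (\<lambda>n. - t n) \<in> C"
  using K_scale[of "\<lambda>n. t n / (1 - wsq t)" "-1"] by (auto simp: C_def cube_def)

lemma zero_in_K: "(\<lambda>n. 0) \<in> K"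
  using K_basis[of 0] K_scale[of _ 0] by auto

lemma zero_in_C: "(\<lambda>n. 0) \<in> C"
  using zero_in_K by (simp add: C_def cube_def)

lemma strict_zero: "strict (\<lambda>n. 0)"
  using strictI[OF zero_in_K, of 0 "\<lambda>n. 0"] by (simp add: wsq_def)

lemma compact_C: "compact C"
proof -
  have "continuous_on cube (\<lambda>t n. t n / (1 - wsq t))"
  proof (rule continuous_on_coordinatewise_then_product)
    have "1 - wsq t \<noteq> 0" if "t \<in> cube" for t
      using wsq_cube_le[OF that] by simp
    then show "continuous_on cube (\<lambda>t. t n / (1 - wsq t))" for n
      by (intro continuous_on_divide continuous_on_diff continuous_on_const continuous_on_wsq
          continuous_on_coordinate) auto
  qed
  moreover have "C = cube \<inter> (\<lambda>t n. t n / (1 - wsq t)) -` K"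
    by (auto simp: C_def)
  ultimately have "closed C"
    using continuous_closed_preimage[OF _ compact_imp_closed[OF compact_cube] compact_imp_closed[OF compact_K]]
    by simp
  moreover have "cube \<inter> C = C"
    using C_cube by blast
  ultimately show ?thesis
    using compact_Int_closed[OF compact_cube, of C] by simp
qed

lemma strict_basis:
  assumes "strict w"
  obtains a e where "0 < a" "\<forall>j<n. e j = 0" "0 < e n" "(\<lambda>k. w k + a * e k) \<in> C" "(\<lambda>k. w k - a * e k) \<in> C"
proof -
  obtain \<delta> where \<delta>: "\<delta> > 0" "\<And>e. e \<in> K \<Longrightarrow> (\<lambda>k. w k + \<delta> * e k) \<in> C"
    using assms unfolding strict_def by blast
  obtain e where e: "e \<in> K" "\<forall>j<n. e j = 0" "0 < e n"
    using K_basis by blast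
  have "(\<lambda>k. w k - \<delta> * e k) \<in> C"
    using \<delta>(2)[of "\<lambda>k. -1 * e k"] K_scale[OF e(1), of "-1"] by simp
  then show ?thesis
    using that[of \<delta> e] \<delta> e by blast
qed

text \<open>The projection of \<open>\<epsilon> K\<close> to finitely many coordinates contains a
  neighbourhood of 0. In the induction, a lift of the first \<open>n\<close> coordinates is
  corrected in coordinate \<open>n\<close> by a multiple of a vector that vanishes before
  \<open>n\<close>.\<close>

lemma lift_small:
  assumes "0 < \<epsilon>"
  shows "\<exists>\<eta>>0. \<forall>d. (\<forall>k<n. \<bar>d k\<bar> < \<eta>) \<longrightarrow> (\<exists>e\<in>K. \<forall>k<n. d k = \<epsilon> * e k)"
  using assms
proof (induction n arbitrary: \<epsilon>)
  case 0
  then show ?case using zero_in_K by (auto intro!: exI[of _ 1])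
next
  case (Suc n)
  obtain b where b: "b \<in> K" "\<forall>j<n. b j = 0" "0 < b n"
    using K_basis by blast
  \<comment> \<open>The bound \<open>\<epsilon> / 2\<close> leaves half of the budget for the
    multiple \<open>c\<close> of \<open>b\<close>. The bound \<open>\<epsilon> * b n / 4\<close>,
    used for both \<open>\<epsilon>'\<close> and \<open>d n\<close>, keeps
    \<open>\<bar>c\<bar>\<close> within that half.\<close>
  define \<epsilon>' where "\<epsilon>' = min (\<epsilon> / 2) (\<epsilon> * b n / 4)"
  have \<epsilon>': "0 < \<epsilon>'" "\<epsilon>' \<le> \<epsilon> / 2" "\<epsilon>' \<le> \<epsilon> * b n / 4"
    using Suc.prems b by (auto simp: \<epsilon>'_def)
  obtain \<eta>' where \<eta>': "\<eta>' > 0" "\<And>d. (\<forall>k<n. \<bar>d k\<bar> < \<eta>') \<Longrightarrow> \<exists>e\<in>K. \<forall>k<n. d k = \<epsilon>' * e k"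
    using Suc.IH[OF \<epsilon>'(1)] by blast
  define \<eta> where "\<eta> = min \<eta>' (\<epsilon> * b n / 4)"
  have "\<exists>e\<in>K. \<forall>k<Suc n. d k = \<epsilon> * e k" if d: "\<forall>k<Suc n. \<bar>d k\<bar> < \<eta>" for d
  proof -
    obtain e where e: "e \<in> K" "\<And>k. k < n \<Longrightarrow> d k = \<epsilon>' * e k"
      using \<eta>'(2)[of d] d by (auto simp: \<eta>_def)
    define c where "c = (d n - \<epsilon>' * e n) / b n"
    have "\<bar>e n\<bar> \<le> 1"
      using e K_cube cubeD by blast
    then have "\<epsilon>' * \<bar>e n\<bar> \<le> \<epsilon>'"
      using \<epsilon>' by (intro mult_left_le) auto
    then have "\<bar>\<epsilon>' * e n\<bar> \<le> \<epsilon>'"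
      using \<epsilon>' by (simp add: abs_mult)
    then have "\<bar>\<epsilon>' * e n\<bar> \<le> \<epsilon> * b n / 4"
      using \<epsilon>'(3) by linarith
    moreover have "\<bar>d n\<bar> < \<epsilon> * b n / 4"
      using d by (auto simp: \<eta>_def)
    ultimately have "\<bar>d n - \<epsilon>' * e n\<bar> \<le> \<epsilon> * b n / 2"
      by linarith
    then have c: "\<bar>c\<bar> \<le> \<epsilon> / 2"
      using b by (simp add: c_def field_simps)
    have "\<bar>\<epsilon>' / \<epsilon>\<bar> + \<bar>c / \<epsilon>\<bar> = (\<epsilon>' + \<bar>c\<bar>) / \<epsilon>"
      using Suc.prems \<epsilon>' by (simp add: add_divide_distrib)
    also have "\<dots> \<le> 1"
      using Suc.prems \<epsilon>' c by simp
    finally have "(\<lambda>k. \<epsilon>' / \<epsilon> * e k + c / \<epsilon> * b k) \<in> K"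
      by (intro K_absconvex e b)
    moreover have "d k = \<epsilon> * (\<epsilon>' / \<epsilon> * e k + c / \<epsilon> * b k)" if "k < Suc n" for k
    proof (cases "k = n")
      case True
      then show ?thesis using Suc.prems b by (simp add: c_def field_simps)
    next
      case False
      then show ?thesis using Suc.prems b e that by simp
    qed
    ultimately show ?thesis
      by (intro bexI[where x = "\<lambda>k. \<epsilon>' / \<epsilon> * e k + c / \<epsilon> * b k"]) auto
  qed
  moreover have "\<eta> > 0"
    using \<eta>' Suc.prems b by (simp add: \<eta>_def)
  ultimately show ?case
    by blast
qed

subsection \<open>Relative coordinates\<close>

definition fiber :: "nat \<Rightarrow> (nat \<Rightarrow> real) \<Rightarrow> (nat \<Rightarrow> real) set"
  where "fiber n t = {u \<in> C. \<forall>k<n. u k = t k}"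

definition hi :: "nat \<Rightarrow> (nat \<Rightarrow> real) \<Rightarrow> real"
  where "hi n t = Sup ((\<lambda>u. u n) ` fiber n t)"

text \<open>\<open>C\<close> is symmetric, so the lower end is obtained by reflection and inherits
  its properties, continuity included, from \<open>hi\<close>.\<close>

definition lo :: "nat \<Rightarrow> (nat \<Rightarrow> real) \<Rightarrow> real"
  where "lo n t = - hi n (\<lambda>k. - t k)"

lemma fiber_refl: "t \<in> C \<Longrightarrow> t \<in> fiber n t"
  by (simp add: fiber_def)

lemma fiber_cong: "(\<And>k. k < n \<Longrightarrow> t k = u k) \<Longrightarrow> fiber n t = fiber n u"
  by (simp add: fiber_def cong: conj_cong)

lemma hi_cong: "(\<And>k. k < n \<Longrightarrow> t k = u k) \<Longrightarrow> hi n t = hi n u"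
  using fiber_cong[of n t u] by (simp add: hi_def)

lemma lo_cong: "(\<And>k. k < n \<Longrightarrow> t k = u k) \<Longrightarrow> lo n t = lo n u"
  unfolding lo_def using hi_cong[of n "\<lambda>k. - t k" "\<lambda>k. - u k"] by simp

lemma fiber_uminus: "u \<in> fiber n t \<Longrightarrow> (\<lambda>k. - u k) \<in> fiber n (\<lambda>k. - t k)"
  by (simp add: fiber_def C_uminus)

lemma closed_agree: "closed {p :: (nat \<Rightarrow> real) \<times> (nat \<Rightarrow> real). \<forall>k<n. snd p k = fst p k}"
proof -
  have "closed {p :: (nat \<Rightarrow> real) \<times> (nat \<Rightarrow> real). snd p k = fst p k}" for k
    by (intro closed_Collect_eq continuous_on_product_then_coordinatewise[OF continuous_on_snd]
        continuous_on_product_then_coordinatewise[OF continuous_on_fst] continuous_on_id)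
  then have "closed (\<Inter>k\<in>{..<n}. {p :: (nat \<Rightarrow> real) \<times> (nat \<Rightarrow> real). snd p k = fst p k})"
    by (intro closed_INT) auto
  moreover have "(\<Inter>k\<in>{..<n}. {p :: (nat \<Rightarrow> real) \<times> (nat \<Rightarrow> real). snd p k = fst p k})
      = {p. \<forall>k<n. snd p k = fst p k}"
    by auto
  ultimately show ?thesis
    by simp
qed

text \<open>The set is the first projection of a compact set of pairs that agree below
  \<open>n\<close>. This yields the semicontinuity of \<open>hi\<close> that needs compactness
  only.\<close>

lemma closed_fiber_meets:
  assumes "closed V"
  shows "closed {t \<in> C. \<exists>u\<in>fiber n t. u n \<in> V}"
proof -
  define D where "D = (C \<times> C) \<inter> ({p. \<forall>k<n. snd p k = fst p k} \<inter> (\<lambda>p. snd p n) -` V)"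
  have "closed ((\<lambda>p :: (nat \<Rightarrow> real) \<times> (nat \<Rightarrow> real). snd p n) -` V)"
    by (intro closed_vimage assms continuous_on_product_then_coordinatewise[OF continuous_on_snd] continuous_on_id)
  then have "compact D"
    unfolding D_def by (intro compact_Int_closed compact_Times compact_C closed_Int closed_agree)
  then have "compact (fst ` D)"
    by (intro compact_continuous_image continuous_on_fst continuous_on_id)
  moreover have "fst ` D = {t \<in> C. \<exists>u\<in>fiber n t. u n \<in> V}"
  proof (intro equalityI subsetI)
    show "t \<in> {t \<in> C. \<exists>u\<in>fiber n t. u n \<in> V}" if "t \<in> fst ` D" for t
      using that by (auto simp: D_def fiber_def)
    fix t assume "t \<in> {t \<in> C. \<exists>u\<in>fiber n t. u n \<in> V}"
    then obtain u where "t \<in> C" "u \<in> fiber n t" "u n \<in> V"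
      by blast
    then have "(t, u) \<in> D"
      by (simp add: D_def fiber_def)
    then show "t \<in> fst ` D"
      by (metis fst_conv image_eqI)
  qed
  ultimately show ?thesis
    by (simp add: compact_imp_closed)
qed

lemma compact_fiber: "compact (fiber n t)"
proof -
  have "closed {u :: nat \<Rightarrow> real. u k = t k}" for k
    by (intro closed_Collect_eq continuous_on_coordinate continuous_on_const)
  then have "closed (\<Inter>k\<in>{..<n}. {u :: nat \<Rightarrow> real. u k = t k})"
    by (intro closed_INT) auto
  then have "compact (C \<inter> (\<Inter>k\<in>{..<n}. {u :: nat \<Rightarrow> real. u k = t k}))"
    by (intro compact_Int_closed compact_C)
  moreover have "C \<inter> (\<Inter>k\<in>{..<n}. {u :: nat \<Rightarrow> real. u k = t k}) = fiber n t"
    by (auto simp: fiber_def)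
  ultimately show ?thesis
    by simp
qed

lemma hi_max: "u \<in> fiber n t \<Longrightarrow> u n \<le> hi n t"
  and hi_attained: "fiber n t \<noteq> {} \<Longrightarrow> \<exists>u\<in>fiber n t. u n = hi n t"
proof -
  have *: "\<exists>u\<in>fiber n t. u n = hi n t \<and> (\<forall>v\<in>fiber n t. v n \<le> hi n t)" if ne: "fiber n t \<noteq> {}"
  proof -
    obtain u where u: "u \<in> fiber n t" "\<forall>v\<in>fiber n t. v n \<le> u n"
      using continuous_attains_sup[OF compact_fiber ne continuous_on_coordinate[of _ n]] by blast
    then have "hi n t = u n"
      unfolding hi_def by (intro cSup_eq_maximum) auto
    then show ?thesis using u by auto
  qed
  show "u \<in> fiber n t \<Longrightarrow> u n \<le> hi n t"
    using * by blast
  show "fiber n t \<noteq> {} \<Longrightarrow> \<exists>u\<in>fiber n t. u n = hi n t"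
    using * by blast
qed

lemma lo_min: "u \<in> fiber n t \<Longrightarrow> lo n t \<le> u n"
  using hi_max[OF fiber_uminus] by (simp add: lo_def minus_le_iff)

lemma lo_attained:
  assumes "fiber n t \<noteq> {}"
  shows "\<exists>u\<in>fiber n t. u n = lo n t"
proof -
  have "fiber n (\<lambda>k. - t k) \<noteq> {}"
    using assms fiber_uminus by blast
  then obtain u where "u \<in> fiber n (\<lambda>k. - t k)" "u n = hi n (\<lambda>k. - t k)"
    using hi_attained by blast
  then show ?thesis
    using fiber_uminus[of u n "\<lambda>k. - t k"] by (intro bexI[of _ "\<lambda>k. - u k"]) (auto simp: lo_def)
qed

lemma lo_le_hi: "t \<in> C \<Longrightarrow> lo n t \<le> hi n t"
  using hi_max lo_min fiber_refl order_trans by metis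

text \<open>In effect, the first \<open>n\<close> coordinates of \<open>t\<close> form an interior
  point of the projection of \<open>C\<close> to these coordinates.\<close>

definition free :: "nat \<Rightarrow> (nat \<Rightarrow> real) \<Rightarrow> bool"
  where "free n t \<longleftrightarrow> (\<exists>w. strict w \<and> (\<forall>k<n. w k = t k))"

text \<open>Mix a minimiser and a maximiser of coordinate \<open>n\<close> over the fiber. If the
  interval is nondegenerate they differ, and a proper mixture is strict by
  \<open>C_mix\<close>.\<close>

lemma fiber_value:
  assumes t: "t \<in> C" and a: "0 \<le> a" "a \<le> 1"
  shows "\<exists>w\<in>fiber n t. w n = (1 - a) * lo n t + a * hi n t \<and>
    (lo n t < hi n t \<and> 0 < a \<and> a < 1 \<longrightarrow> strict w)"
proof -
  obtain u v where u: "u \<in> fiber n t" "u n = lo n t" and v: "v \<in> fiber n t" "v n = hi n t"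
    using hi_attained lo_attained fiber_refl[OF t] by blast
  have C: "u \<in> C" "v \<in> C"
    using u v by (auto simp: fiber_def)
  show ?thesis
  proof (intro bexI conjI impI)
    show "(\<lambda>k. (1 - a) * u k + a * v k) \<in> fiber n t"
      using C_mix(1)[OF C a] u v by (auto simp: fiber_def algebra_simps)
    show "strict (\<lambda>k. (1 - a) * u k + a * v k)" if "lo n t < hi n t \<and> 0 < a \<and> a < 1"
      using C_mix(2)[OF C a, of n] that u v by simp
  qed (simp add: u v)
qed

text \<open>From \<open>w\<close> one can move in both directions along a vector that vanishes
  before \<open>n\<close> and is positive at \<open>n\<close>, without leaving the fiber.\<close>

lemma strict_bounds:
  assumes "strict w" "\<forall>k<n. w k = t k"
  shows "lo n t < w n" "w n < hi n t"
proof -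
  obtain a e where a: "0 < a" "\<forall>j<n. e j = 0" "0 < e n" "(\<lambda>k. w k + a * e k) \<in> C" "(\<lambda>k. w k - a * e k) \<in> C"
    using strict_basis[OF assms(1)] .
  then have "0 < a * e n"
    by simp
  moreover have "w n + a * e n \<le> hi n t"
    using hi_max[of "\<lambda>k. w k + a * e k" n t] a assms by (simp add: fiber_def)
  moreover have "lo n t \<le> w n - a * e n"
    using lo_min[of "\<lambda>k. w k - a * e k" n t] a assms by (simp add: fiber_def)
  ultimately show "lo n t < w n" "w n < hi n t"
    by linarith+
qed

text \<open>One direction is \<open>strict_bounds\<close>; for the other, \<open>fiber_value\<close>
  makes the midpoint of the interval the value of a strict point of the fiber.\<close>

lemma free_iff: "t \<in> C \<Longrightarrow> free n t \<longleftrightarrow> lo n t < hi n t"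
  using strict_bounds[of _ n t] fiber_value[of t "1/2" n]
  unfolding free_def fiber_def by fastforce

text \<open>Take a strict point \<open>w\<close> of the fiber whose value \<open>m'\<close> lies
  between \<open>m\<close> and \<open>hi n t\<close>. For \<open>t'\<close> close to
  \<open>t\<close>, \<open>lift_small\<close> gives a small \<open>\<epsilon> * e\<close> that moves
  \<open>w\<close> into the fiber of \<open>t'\<close>, and coordinate \<open>n\<close> drops by at
  most \<open>\<epsilon>\<close>.\<close>

lemma hi_lower_semicontinuous:
  assumes t: "t \<in> C" and m: "m < hi n t" and less: "lo n t < hi n t"
  shows "\<exists>\<eta>>0. \<forall>t'\<in>C. (\<forall>k<n. \<bar>t' k - t k\<bar> < \<eta>) \<longrightarrow> m < hi n t'"
proof -
  obtain m' where m': "max m (lo n t) < m'" "m' < hi n t"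
    using dense[of "max m (lo n t)" "hi n t"] m less by auto
  define a where "a = (m' - lo n t) / (hi n t - lo n t)"
  have a: "0 < a" "a < 1"
    using m' less by (auto simp: a_def)
  have "a * (hi n t - lo n t) = m' - lo n t"
    using less by (simp add: a_def)
  then have val: "(1 - a) * lo n t + a * hi n t = m'"
    by (simp add: algebra_simps)
  obtain w where w: "w \<in> fiber n t" "w n = m'" "strict w"
    using fiber_value[OF t, of a n] a less val by auto
  obtain \<delta> where \<delta>: "\<delta> > 0" "\<And>e. e \<in> K \<Longrightarrow> (\<lambda>k. w k + \<delta> * e k) \<in> C"
    using w(3) unfolding strict_def by blast
  \<comment> \<open>At most \<open>\<delta>\<close>, so that the moved point stays in
    \<open>C\<close>; less than \<open>m' - m\<close>, so that its coordinate \<open>n\<close> stays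
    above \<open>m\<close>.\<close>
  define \<epsilon> where "\<epsilon> = min \<delta> ((m' - m) / 2)"
  have \<epsilon>: "0 < \<epsilon>" "\<epsilon> \<le> \<delta>" "\<epsilon> < m' - m"
    using m' \<delta> by (auto simp: \<epsilon>_def min_less_iff_disj)
  obtain \<eta> where \<eta>: "\<eta> > 0" "\<And>d. (\<forall>k<n. \<bar>d k\<bar> < \<eta>) \<Longrightarrow> \<exists>e\<in>K. \<forall>k<n. d k = \<epsilon> * e k"
    using lift_small[OF \<epsilon>(1), of n] by blast
  have "m < hi n t'" if t': "t' \<in> C" "\<forall>k<n. \<bar>t' k - t k\<bar> < \<eta>" for t'
  proof -
    obtain e where e: "e \<in> K" "\<forall>k<n. t' k - t k = \<epsilon> * e k"
      using \<eta>(2)[of "\<lambda>k. t' k - t k"] t'(2) by blast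
    have "(\<lambda>k. \<epsilon> / \<delta> * e k) \<in> K"
      using K_scale[OF e(1), of "\<epsilon> / \<delta>"] \<epsilon> \<delta> by simp
    from \<delta>(2)[OF this] have "(\<lambda>k. w k + \<epsilon> * e k) \<in> C"
      using \<delta>(1) by simp
    then have "(\<lambda>k. w k + \<epsilon> * e k) \<in> fiber n t'"
      using e(2) w(1) by (auto simp: fiber_def)
    then have "m' + \<epsilon> * e n \<le> hi n t'"
      using hi_max w(2) by fastforce
    moreover have "- 1 \<le> e n"
      using e(1) K_cube cubeD[of e n] by (auto simp: abs_le_iff)
    then have "\<epsilon> * - 1 \<le> \<epsilon> * e n"
      using \<epsilon>(1) by (intro mult_left_mono) auto
    ultimately show ?thesis
      using \<epsilon>(3) by linarith
  qed
  then show ?thesis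
    using \<eta>(1) by blast
qed

lemma eventually_avoids_closed:
  "closed Z \<Longrightarrow> t \<notin> Z \<Longrightarrow> \<forall>\<^sub>F x in at t within S. x \<notin> Z"
  unfolding eventually_at_topological by (auto intro!: exI[of _ "- Z"])

lemma eventually_in_within: "\<forall>\<^sub>F x in at t within S. x \<in> S"
  unfolding eventually_at_topological by auto

lemma continuous_on_hi: "continuous_on C (hi n)"
  unfolding continuous_on_def
proof (intro ballI order_tendstoI)
  fix t m assume t: "t \<in> C" and m: "m < hi n t"
  show "\<forall>\<^sub>F t' in at t within C. m < hi n t'"
  proof (cases "lo n t < hi n t")
    case True
    then obtain \<eta> where \<eta>: "\<eta> > 0" "\<And>t'. t' \<in> C \<Longrightarrow> (\<forall>k<n. \<bar>t' k - t k\<bar> < \<eta>) \<Longrightarrow> m < hi n t'"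
      using hi_lower_semicontinuous[OF t m] by blast
    have "\<forall>\<^sub>F t' in at t within C. \<bar>t' k - t k\<bar> < \<eta>" for k
      using continuous_on_coordinate[of C k] t \<eta>(1)
      unfolding continuous_on_def by (auto dest!: tendstoD simp: dist_real_def)
    then have "\<forall>\<^sub>F t' in at t within C. \<forall>k\<in>{..<n}. \<bar>t' k - t k\<bar> < \<eta>"
      by (intro eventually_ball_finite) auto
    then show ?thesis
      using eventually_in_within by eventually_elim (use \<eta>(2) in auto)
  next
    case False
    \<comment> \<open>In a degenerate fiber every point has the value \<open>hi n t > m\<close>, so
      no value is in \<open>{..m}\<close>. This persists nearby because the set of exceptions is
      closed.\<close>
    have "t \<notin> {t \<in> C. \<exists>u\<in>fiber n t. u n \<in> {..m}}"
      using False m lo_min[of _ n t] by fastforce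
    from eventually_avoids_closed[OF closed_fiber_meets[OF closed_atMost] this] show ?thesis
      using eventually_in_within
    proof eventually_elim
      case (elim t')
      then have "\<not> t' n \<le> m"
        using fiber_refl[of t' n] by blast
      then show ?case
        using hi_max[OF fiber_refl[of t' n]] elim(2) by simp
    qed
  qed
next
  fix t m assume t: "t \<in> C" and m: "hi n t < m"
  \<comment> \<open>Upper semicontinuity: no point of the fiber reaches \<open>m\<close>, which
    again persists nearby, and \<open>hi n t'\<close> is attained.\<close>
  have "t \<notin> {t \<in> C. \<exists>u\<in>fiber n t. u n \<in> {m..}}"
    using m hi_max[of _ n t] by fastforce
  from eventually_avoids_closed[OF closed_fiber_meets[OF closed_atLeast] this]
  show "\<forall>\<^sub>F t' in at t within C. hi n t' < m"
    using eventually_in_within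
  proof eventually_elim
    case (elim t')
    obtain u where "u \<in> fiber n t'" "u n = hi n t'"
      using hi_attained[of n t'] fiber_refl[OF elim(2)] by blast
    then have "\<not> m \<le> hi n t'"
      using elim by auto
    then show ?case
      by simp
  qed
qed

lemma continuous_on_lo: "continuous_on C (lo n)"
proof -
  have "continuous_on C (\<lambda>t k. - t k)"
    by (intro continuous_on_coordinatewise_then_product continuous_on_minus continuous_on_coordinate)
  moreover have "(\<lambda>t k. - t k) ` C \<subseteq> C"
    using C_uminus by blast
  ultimately have "continuous_on C (\<lambda>t. hi n (\<lambda>k. - t k))"
    using continuous_on_compose2[OF continuous_on_hi] by blast
  then show ?thesis
    unfolding lo_def by (intro continuous_on_minus)
qed

text \<open>Relative position of \<open>t n\<close> in \<open>[lo n t, hi n t]\<close>, with \<open>- 1\<close> and \<open>1\<close> for the end points;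
  any \<open>\<theta> n\<close> is admissible when the interval degenerates.\<close>

definition param :: "nat \<Rightarrow> (nat \<Rightarrow> real) \<Rightarrow> (nat \<Rightarrow> real) \<Rightarrow> bool"
  where "param n \<theta> t \<longleftrightarrow> 2 * t n = hi n t + lo n t + \<theta> n * (hi n t - lo n t)"

lemma param_cong: "(\<And>k. k \<le> n \<Longrightarrow> t k = u k) \<Longrightarrow> param n \<theta> t \<longleftrightarrow> param n \<theta> u"
  unfolding param_def using hi_cong[of n t u] lo_cong[of n t u] by simp

text \<open>Finitely many coordinates are prescribed one after another by
  \<open>fiber_value\<close>, with weight \<open>(1 + \<theta> n) / 2\<close>. The conditions are
  closed since \<open>hi\<close> and \<open>lo\<close> are continuous, so compactness of
  \<open>C\<close> satisfies all of them at once.\<close>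

lemma ex_param_point:
  assumes \<theta>: "\<theta> \<in> cube"
  shows "\<exists>t\<in>C. \<forall>n. param n \<theta> t"
proof -
  have ex: "\<exists>t\<in>C. \<forall>k<n. param k \<theta> t" for n
  proof (induction n)
    case 0
    then show ?case using zero_in_C by auto
  next
    case (Suc n)
    then obtain t where t: "t \<in> C" "\<forall>k<n. param k \<theta> t"
      by blast
    have "\<bar>\<theta> n\<bar> \<le> 1"
      using cubeD[OF \<theta>] .
    then obtain w where w: "w \<in> fiber n t" "w n = (1 - (1 + \<theta> n) / 2) * lo n t + (1 + \<theta> n) / 2 * hi n t"
      using fiber_value[OF t(1), of "(1 + \<theta> n) / 2" n] by (auto simp: abs_le_iff)
    have agree: "w k = t k" if "k < n" for k
      using w that by (simp add: fiber_def)
    have "param k \<theta> w" if "k < n" for k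
      using t(2) that param_cong[of k w t] agree by auto
    moreover have "2 * w n = hi n t + lo n t + \<theta> n * (hi n t - lo n t)"
      unfolding w(2) by (simp add: field_simps)
    then have "param n \<theta> w"
      unfolding param_def using hi_cong[of n w t] lo_cong[of n w t] agree by simp
    ultimately show ?case
      using w(1) by (auto simp: fiber_def less_Suc_eq)
  qed
  have "C \<inter> (\<Inter>n\<in>UNIV. {t \<in> C. param n \<theta> t}) \<noteq> {}"
  proof (rule compact_imp_fip_image[OF compact_C])
    have "closed {t \<in> C. 2 * t n - (hi n t + lo n t + \<theta> n * (hi n t - lo n t)) = 0}" for n
      by (intro continuous_closed_preimage_constant compact_imp_closed[OF compact_C]
          continuous_on_diff continuous_on_add continuous_on_mult continuous_on_const
          continuous_on_coordinate continuous_on_hi continuous_on_lo)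
    then show "closed {t \<in> C. param n \<theta> t}" for n
      by (simp add: param_def)
    fix I :: "nat set" assume "finite I"
    then obtain m where m: "\<forall>i\<in>I. i < m"
      using finite_nat_set_iff_bounded by blast
    obtain t where "t \<in> C" "\<forall>k<m. param k \<theta> t"
      using ex by blast
    then show "C \<inter> (\<Inter>n\<in>I. {t \<in> C. param n \<theta> t}) \<noteq> {}"
      using m by blast
  qed
  then show ?thesis
    by blast
qed

lemma ex_param_value:
  assumes t: "t \<in> C"
  shows "\<exists>\<theta>\<in>cube. \<forall>n. param n \<theta> t"
proof -
  have "\<exists>x. \<bar>x\<bar> \<le> 1 \<and> 2 * t n = hi n t + lo n t + x * (hi n t - lo n t)" for n
  proof (cases "lo n t < hi n t")
    case True
    then show ?thesis
      using hi_max[OF fiber_refl[OF t], of n] lo_min[OF fiber_refl[OF t], of n]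
      by (intro exI[of _ "(2 * t n - (hi n t + lo n t)) / (hi n t - lo n t)"])
        (simp add: abs_le_iff divide_le_eq le_divide_eq)
  next
    case False
    \<comment> \<open>Here \<open>t n\<close> equals both end points, and 0 is an arbitrary
      choice.\<close>
    then show ?thesis
      using lo_le_hi[OF t, of n] hi_max[OF fiber_refl[OF t], of n] lo_min[OF fiber_refl[OF t], of n]
      by (intro exI[of _ 0]) auto
  qed
  then obtain \<theta> where "\<And>n. \<bar>\<theta> n\<bar> \<le> 1 \<and> 2 * t n = hi n t + lo n t + \<theta> n * (hi n t - lo n t)"
    by metis
  then show ?thesis
    by (intro bexI[of _ \<theta>]) (auto simp: param_def cube_def)
qed

text \<open>Induction through \<open>free (Suc n) t \<longleftrightarrow> free n t \<and>
  \<bar>\<theta> n\<bar> < 1\<close>: a strict extension lies strictly inside the interval at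
  \<open>n\<close>, and conversely each inner value of a nondegenerate interval is taken by a strict
  point.\<close>

lemma free_iff_param:
  assumes t: "t \<in> C" and \<theta>: "\<theta> \<in> cube" and param: "\<And>n. param n \<theta> t"
  shows "free n t \<longleftrightarrow> (\<forall>k<n. \<bar>\<theta> k\<bar> < 1)"
proof (induction n)
  case 0
  then show ?case using strict_zero by (auto simp: free_def)
next
  case (Suc n)
  have p: "2 * t n = hi n t + lo n t + \<theta> n * (hi n t - lo n t)"
    using param by (simp add: param_def)
  have "free (Suc n) t \<longleftrightarrow> free n t \<and> \<bar>\<theta> n\<bar> < 1"
  proof
    assume "free (Suc n) t"
    then obtain w where w: "strict w" "\<forall>k<Suc n. w k = t k"
      by (auto simp: free_def)
    then have t: "free n t" "lo n t < t n" "t n < hi n t"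
      using strict_bounds[OF w(1), of n t] by (auto simp: free_def)
    obtain x where x: "x = \<theta> n * (hi n t - lo n t)"
      by simp
    have "x < 1 * (hi n t - lo n t)"
      using p[folded x] t by simp
    moreover have "- 1 * (hi n t - lo n t) < x"
      using p[folded x] t by simp
    ultimately show "free n t \<and> \<bar>\<theta> n\<bar> < 1"
      using t unfolding x mult_less_cancel_right by auto
  next
    assume *: "free n t \<and> \<bar>\<theta> n\<bar> < 1"
    then have less: "lo n t < hi n t"
      using free_iff[OF t] by blast
    obtain w where w: "w \<in> fiber n t" "strict w"
      "w n = (1 - (1 + \<theta> n) / 2) * lo n t + (1 + \<theta> n) / 2 * hi n t"
      using fiber_value[OF t, of "(1 + \<theta> n) / 2" n] * less by (auto simp: abs_less_iff)
    have "2 * w n = 2 * t n"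
      unfolding p w(3) by (simp add: field_simps)
    then show "free (Suc n) t"
      using w by (auto simp: free_def fiber_def less_Suc_eq)
  qed
  then show ?case
    using Suc.IH by (auto simp: less_Suc_eq)
qed

text \<open>\<open>\<theta>\<close> is not determined by \<open>t\<close> at degenerate intervals. But by \<open>free_iff_param\<close> an interval is degenerate
  iff some earlier \<open>\<theta> k\<close> is an end point, which \<open>g\<close> respects.\<close>

lemma param_reparam_unique:
  assumes t: "t \<in> C" and y: "y \<in> C" "y' \<in> C"
    and \<theta>: "\<theta> \<in> cube" "\<theta>' \<in> cube" "(\<lambda>n. g n (\<theta> n)) \<in> cube" "(\<lambda>n. g n (\<theta>' n)) \<in> cube"
    and param: "\<And>n. param n \<theta> t" "\<And>n. param n \<theta>' t"
      "\<And>n. param n (\<lambda>n. g n (\<theta> n)) y" "\<And>n. param n (\<lambda>n. g n (\<theta>' n)) y'"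
    and g: "\<And>n x. \<bar>x\<bar> \<le> 1 \<Longrightarrow> \<bar>g n x\<bar> < 1 \<longleftrightarrow> \<bar>x\<bar> < 1"
  shows "y = y'"
proof
  fix n
  show "y n = y' n"
  proof (induction n rule: less_induct)
    case (less n)
    then have cong: "hi n y' = hi n y" "lo n y' = lo n y"
      using hi_cong[of n y y'] lo_cong[of n y y'] by auto
    have p: "2 * y n = hi n y + lo n y + g n (\<theta> n) * (hi n y - lo n y)"
        "2 * y' n = hi n y + lo n y + g n (\<theta>' n) * (hi n y - lo n y)"
      using param(3)[of n] param(4)[of n] by (simp_all add: param_def cong)
    have "free n t \<longleftrightarrow> free n y"
      using free_iff_param[OF t \<theta>(1) param(1)] free_iff_param[OF y(1) \<theta>(3) param(3)]
        g cubeD[OF \<theta>(1)] by simp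
    \<comment> \<open>Either the interval of \<open>t\<close> determines \<open>\<theta> n\<close>,
      or the interval of \<open>y\<close> is a single point and the parameter has no
      influence.\<close>
    then consider "lo n t < hi n t" | "\<not> lo n y < hi n y"
      using free_iff t y by blast
    then show ?case
    proof cases
      case 1
      then have "\<theta> n = \<theta>' n"
        using param(1)[of n] param(2)[of n] by (simp add: param_def)
      then show ?thesis
        using p by simp
    next
      case 2
      then have "hi n y = lo n y"
        using lo_le_hi[OF y(1), of n] by simp
      then show ?thesis
        using p by simp
    qed
  qed
qed

lemma closed_param:
  assumes S: "closed S" and a: "continuous_on S a" and b: "continuous_on S b" "b ` S \<subseteq> C"
  shows "closed {p \<in> S. 2 * b p n = hi n (b p) + lo n (b p) + a p * (hi n (b p) - lo n (b p))}"
proof -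
  have "closed {p \<in> S. 2 * b p n - (hi n (b p) + lo n (b p) + a p * (hi n (b p) - lo n (b p))) = 0}"
    by (intro continuous_closed_preimage_constant S continuous_on_diff continuous_on_add
        continuous_on_mult continuous_on_const continuous_on_product_then_coordinatewise[OF b(1)] a
        continuous_on_compose2[OF continuous_on_hi b] continuous_on_compose2[OF continuous_on_lo b])
  then show ?thesis
    by simp
qed

text \<open>Relate \<open>t\<close> to \<open>y\<close> if some \<open>\<theta>\<close> describes
  \<open>t\<close> while its image under \<open>g\<close> describes \<open>y\<close>. This relation
  \<open>R\<close> is the projection of a compact set, total on both sides by the existence lemmas,
  and single-valued both ways by \<open>param_reparam_unique\<close>, so it is the graph of a
  homeomorphism.\<close>

lemma reparam_homeomorphism:
  fixes g h :: "nat \<Rightarrow> real \<Rightarrow> real"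
  assumes g: "\<And>n x. \<bar>x\<bar> \<le> 1 \<Longrightarrow> \<bar>g n x\<bar> \<le> 1" "\<And>n x. \<bar>x\<bar> \<le> 1 \<Longrightarrow> \<bar>g n x\<bar> < 1 \<longleftrightarrow> \<bar>x\<bar> < 1"
    and h: "\<And>n x. \<bar>x\<bar> \<le> 1 \<Longrightarrow> \<bar>h n x\<bar> \<le> 1" "\<And>n x. \<bar>x\<bar> \<le> 1 \<Longrightarrow> \<bar>h n x\<bar> < 1 \<longleftrightarrow> \<bar>x\<bar> < 1"
    and gh: "\<And>n x. g n (h n x) = x" "\<And>n x. h n (g n x) = x"
    and cont: "\<And>n. continuous_on {-1..1} (g n)"
  shows "\<exists>F F'. homeomorphism C C F F' \<and> (\<forall>\<theta>\<in>cube. \<forall>t\<in>C. \<forall>y\<in>C.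
    (\<forall>n. param n \<theta> t) \<and> (\<forall>n. param n (\<lambda>n. g n (\<theta> n)) y) \<longrightarrow> F t = y)"
proof -
  define S where "S = cube \<times> (C \<times> C)"
  define D where "D = S \<inter> (\<Inter>n. {p \<in> S. param n (fst p) (fst (snd p))}
    \<inter> {p \<in> S. param n (\<lambda>k. g k (fst p k)) (snd (snd p))})"
  define R where "R = snd ` D"
  have R_iff: "(t, y) \<in> R \<longleftrightarrow> t \<in> C \<and> y \<in> C \<and>
      (\<exists>\<theta>\<in>cube. \<forall>n. param n \<theta> t \<and> param n (\<lambda>k. g k (\<theta> k)) y)" for t y
  proof
    assume "(t, y) \<in> R"
    then show "t \<in> C \<and> y \<in> C \<and> (\<exists>\<theta>\<in>cube. \<forall>n. param n \<theta> t \<and> param n (\<lambda>k. g k (\<theta> k)) y)"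
      unfolding R_def D_def S_def by fastforce
  next
    assume "t \<in> C \<and> y \<in> C \<and> (\<exists>\<theta>\<in>cube. \<forall>n. param n \<theta> t \<and> param n (\<lambda>k. g k (\<theta> k)) y)"
    then obtain \<theta> where "(\<theta>, t, y) \<in> D"
      unfolding D_def S_def by auto
    then show "(t, y) \<in> R"
      unfolding R_def by (metis image_eqI snd_conv)
  qed
  have gcube: "(\<lambda>n. g n (\<theta> n)) \<in> cube" if "\<theta> \<in> cube" for \<theta>
    using g(1) that by (simp add: cube_def)
  have S: "compact S"
    unfolding S_def by (intro compact_Times compact_cube compact_C)
  then have cS: "closed S"
    by (rule compact_imp_closed)
  have proj: "continuous_on S (\<lambda>p. fst p n)" "continuous_on S (\<lambda>p. fst (snd p))"
      "continuous_on S (\<lambda>p. snd (snd p))" for n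
    by (intro continuous_on_product_then_coordinatewise[OF continuous_on_fst] continuous_on_fst
        continuous_on_snd continuous_on_id)+
  have im: "(\<lambda>p. fst (snd p)) ` S \<subseteq> C" "(\<lambda>p. snd (snd p)) ` S \<subseteq> C"
    by (auto simp: S_def)
  have "(\<lambda>p. fst p n) ` S \<subseteq> {-1..1}" for n
    using cubeD by (force simp: S_def abs_le_iff)
  then have "continuous_on S (\<lambda>p. g n (fst p n))" for n
    by (rule continuous_on_compose2[OF cont proj(1)])
  then have "compact D"
    unfolding D_def param_def
    by (intro compact_Int_closed S closed_INT ballI closed_Int closed_param cS proj im)
  then have R: "compact R"
    unfolding R_def by (intro compact_continuous_image continuous_on_snd continuous_on_id)
  have inj1: "y = y'" if R: "(t, y) \<in> R" "(t, y') \<in> R" for t y y'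
  proof -
    obtain \<theta> \<theta>' where "\<theta> \<in> cube" "\<theta>' \<in> cube" "\<forall>n. param n \<theta> t" "\<forall>n. param n \<theta>' t"
      "\<forall>n. param n (\<lambda>n. g n (\<theta> n)) y" "\<forall>n. param n (\<lambda>n. g n (\<theta>' n)) y'" "t \<in> C" "y \<in> C" "y' \<in> C"
      using R unfolding R_iff by blast
    then show ?thesis
      using param_reparam_unique[of t y y' \<theta> \<theta>' g] gcube g(2) by blast
  qed
  \<comment> \<open>The uniqueness lemma applied backwards: \<open>h\<close> turns the parameters of
    \<open>y\<close> into those of \<open>t\<close> and \<open>t'\<close>.\<close>
  have inj2: "t = t'" if R: "(t, y) \<in> R" "(t', y) \<in> R" for t t' y
  proof -
    obtain \<theta> \<theta>' where *: "\<theta> \<in> cube" "\<theta>' \<in> cube" "\<forall>n. param n \<theta> t" "\<forall>n. param n \<theta>' t'"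
      "\<forall>n. param n (\<lambda>n. g n (\<theta> n)) y" "\<forall>n. param n (\<lambda>n. g n (\<theta>' n)) y" "t \<in> C" "t' \<in> C" "y \<in> C"
      using R unfolding R_iff by blast
    show ?thesis
      using param_reparam_unique[of y t t' "\<lambda>n. g n (\<theta> n)" "\<lambda>n. g n (\<theta>' n)" h] * gcube h(2)
      by (simp add: gh)
  qed
  have ex: "\<exists>y. (t, y) \<in> R" if t: "t \<in> C" for t
  proof -
    obtain \<theta> where \<theta>: "\<theta> \<in> cube" "\<forall>n. param n \<theta> t"
      using ex_param_value[OF t] by blast
    obtain y where "y \<in> C" "\<forall>n. param n (\<lambda>n. g n (\<theta> n)) y"
      using ex_param_point[OF gcube[OF \<theta>(1)]] by blast
    then show ?thesis
      using \<theta> t unfolding R_iff by blast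
  qed
  have ex': "\<exists>t. (t, y) \<in> R" if y: "y \<in> C" for y
  proof -
    obtain \<theta> where \<theta>: "\<theta> \<in> cube" "\<forall>n. param n \<theta> y"
      using ex_param_value[OF y] by blast
    have hc: "(\<lambda>n. h n (\<theta> n)) \<in> cube"
      using h(1) \<theta>(1) by (simp add: cube_def)
    obtain t where "t \<in> C" "\<forall>n. param n (\<lambda>n. h n (\<theta> n)) t"
      using ex_param_point[OF hc] by blast
    then show ?thesis
      using \<theta> y hc unfolding R_iff by (intro exI[of _ t] conjI bexI[OF _ hc]) (auto simp: gh)
  qed
  have inj: "inj_on fst R" "inj_on snd R"
    using inj1 inj2 by (auto simp: inj_on_def)
  have "fst ` R = C"
  proof (intro equalityI subsetI)
    show "t \<in> C" if "t \<in> fst ` R" for t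
      using that R_iff by auto
    show "t \<in> fst ` R" if "t \<in> C" for t
      using ex[OF that] by (metis fst_conv image_eqI)
  qed
  moreover have "snd ` R = C"
  proof (intro equalityI subsetI)
    show "t \<in> C" if "t \<in> snd ` R" for t
      using that R_iff by auto
    show "t \<in> snd ` R" if "t \<in> C" for t
      using ex'[OF that] by (metis snd_conv image_eqI)
  qed
  ultimately obtain F F' where F: "homeomorphism C C F F'" "\<forall>t\<in>C. (t, F t) \<in> R"
    using homeomorphism_of_compact_graph[OF R inj] by blast
  have "F t = y" if "\<theta> \<in> cube" "t \<in> C" "y \<in> C" "\<forall>n. param n \<theta> t" "\<forall>n. param n (\<lambda>n. g n (\<theta> n)) y"
    for \<theta> t y
  proof -
    have "(t, y) \<in> R"
      unfolding R_iff using that by blast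
    then show ?thesis
      using inj1 F(2) that(2) by blast
  qed
  then show ?thesis
    using F(1) by blast
qed

section \<open>A wild homeomorphism of a sequence body\<close>

definition dilate :: "(nat \<Rightarrow> real) \<Rightarrow> nat \<Rightarrow> real"
  where "dilate t = (\<lambda>n. t n / (1 - wsq t))"

text \<open>\<open>dilate\<close> stretches each ray so that the boundary of \<open>C\<close>, where
  the gauge is \<open>1 - wsq t\<close>, goes to gauge 1. Since \<open>C\<close> is compact,
  continuity and bijectivity suffice.\<close>

lemma homeomorphism_dilate: "\<exists>D'. homeomorphism C K dilate D'"
proof (rule homeomorphism_compact[OF compact_C])
  show "continuous_on C dilate"
    unfolding dilate_def
  proof (rule continuous_on_coordinatewise_then_product)
    have "1 - wsq t \<noteq> 0" if "t \<in> C" for t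
      using wsq_cube_le[OF C_cube[OF that]] by simp
    moreover have "continuous_on C wsq"
      using continuous_on_subset[OF continuous_on_wsq] C_cube by blast
    ultimately show "continuous_on C (\<lambda>t. t n / (1 - wsq t))" for n
      by (intro continuous_on_divide continuous_on_diff continuous_on_const continuous_on_coordinate) auto
  qed
  show "inj_on dilate C"
  proof (rule inj_onI)
    fix t u assume t: "t \<in> C" and u: "u \<in> C" and eq: "dilate t = dilate u"
    define c where "c = dilate t"
    have "c \<in> K"
      using t by (simp add: c_def dilate_def C_def)
    then have c: "\<bar>c n\<bar> \<le> 1" for n
      using K_cube cubeD by blast
    have wsq: "wsq v = (1 - wsq v)\<^sup>2 * wsq c" and scale: "v = (\<lambda>n. (1 - wsq v) * c n)"
      and pos: "0 < 1 - wsq v" if "v \<in> C" "dilate v = c" for v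
    proof -
      show "0 < 1 - wsq v"
        using wsq_cube_le[OF C_cube[OF that(1)]] by simp
      then show eq: "v = (\<lambda>n. (1 - wsq v) * c n)"
        using that(2) by (auto simp: dilate_def)
      have "wsq v = wsq (\<lambda>n. (1 - wsq v) * c n)"
        using eq by (rule arg_cong)
      also have "\<dots> = (1 - wsq v)\<^sup>2 * wsq c"
        using c by (rule wsq_scale)
      finally show "wsq v = (1 - wsq v)\<^sup>2 * wsq c" .
    qed
    have "wsq t - wsq u = ((1 - wsq t)\<^sup>2 - (1 - wsq u)\<^sup>2) * wsq c"
      using wsq[OF t] wsq[OF u] eq by (simp add: c_def left_diff_distrib)
    \<comment> \<open>The difference of squares is factored; the second factor is at least 1, so
      \<open>wsq t = wsq u\<close>, and then \<open>c\<close> determines the point.\<close>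
    then have "(wsq t - wsq u) * (1 + ((1 - wsq t) + (1 - wsq u)) * wsq c) = 0"
      by (simp add: power2_eq_square algebra_simps)
    moreover have "0 \<le> ((1 - wsq t) + (1 - wsq u)) * wsq c"
      using pos[OF t] pos[OF u] eq wsq_nonneg[of c, OF c] by (simp add: c_def)
    ultimately have "wsq t = wsq u"
      by simp
    then show "t = u"
      using scale[OF t] scale[OF u] eq by (metis c_def)
  qed
  show "dilate ` C = K"
  proof (intro equalityI subsetI)
    show "c \<in> K" if "c \<in> dilate ` C" for c
      using that by (auto simp: dilate_def C_def)
    fix c assume c: "c \<in> K"
    have cb: "\<bar>c n\<bar> \<le> 1" for n
      using c K_cube cubeD by blast
    \<comment> \<open>The preimage is \<open>r * c\<close> with \<open>1 - r^2 * wsq c = r\<close>;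
      the positive root is \<open>r = 2 / (1 + s)\<close>, a form that also covers
      \<open>wsq c = 0\<close>.\<close>
    define s where "s = sqrt (1 + 4 * wsq c)"
    define t where "t = (\<lambda>n. 2 / (1 + s) * c n)"
    have q: "0 \<le> wsq c"
      using wsq_nonneg[of c, OF cb] .
    have s: "0 \<le> s" "s\<^sup>2 = 1 + 4 * wsq c"
      using q by (simp_all add: s_def)
    have "4 * wsq c = (s - 1) * (s + 1)"
      using s(2) by (simp add: power2_eq_square algebra_simps)
    then have "(2 / (1 + s))\<^sup>2 * wsq c = (s - 1) / (1 + s)"
      using s(1) by (simp add: power_divide power2_eq_square divide_simps)
    then have "wsq t = (s - 1) / (1 + s)"
      using wsq_scale[OF cb, of "2 / (1 + s)"] by (simp add: t_def)
    also have "\<dots> = 1 - 2 / (1 + s)"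
      using s(1) by (simp add: divide_simps)
    finally have wt: "1 - wsq t = 2 / (1 + s)"
      by simp
    have "t \<in> C"
    proof (rule C_I[OF c])
      show "t n = 2 / (1 + s) * c n" for n
        by (simp add: t_def)
      show "0 \<le> 2 / (1 + s)" "2 / (1 + s) \<le> 1 - wsq t"
        using s(1) wt by auto
    qed
    moreover have "dilate t = c"
      unfolding dilate_def wt using s(1) by (simp add: t_def)
    ultimately show "c \<in> dilate ` C"
      by blast
  qed
qed

lemma hi_zero_pos: "0 < hi n (\<lambda>_. 0)"
  using strict_bounds(2)[OF strict_zero, of n "\<lambda>_. 0"] by simp

lemma lo_zero: "lo n (\<lambda>_. 0) = - hi n (\<lambda>_. 0)"
  by (simp add: lo_def)

text \<open>In terms of the gauge of \<open>K\<close>, the point \<open>\<epsilon> * w\<close> has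
  size at most \<open>\<epsilon>\<close>, while its image has size above 1/4. The map is the
  reparametrization of \<open>C\<close> by odd roots, conjugated by \<open>dilate\<close>.\<close>

lemma ex_wild_homeomorphism:
  "\<exists>f f'. homeomorphism K K f f' \<and> f (\<lambda>_. 0) = (\<lambda>_. 0) \<and>
    (\<forall>\<epsilon>>0. \<exists>w\<in>K. (\<lambda>n. \<epsilon> * w n) \<in> K \<and> (\<forall>c\<in>K. f (\<lambda>n. \<epsilon> * w n) \<noteq> (\<lambda>n. c n / 4)))"
proof -
  define g where "g = (\<lambda>n. root (2 * n + 1))"
  define h where "h = (\<lambda>n x :: real. x ^ (2 * n + 1))"
  have root_abs: "\<bar>g n x\<bar> = root (2 * n + 1) \<bar>x\<bar>" for n x
    by (simp add: g_def real_root_abs)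
  have "\<exists>F F'. homeomorphism C C F F' \<and> (\<forall>\<theta>\<in>cube. \<forall>t\<in>C. \<forall>y\<in>C.
    (\<forall>n. param n \<theta> t) \<and> (\<forall>n. param n (\<lambda>n. g n (\<theta> n)) y) \<longrightarrow> F t = y)"
  proof (rule reparam_homeomorphism[where h = h])
    show "continuous_on {-1..1} (g n)" for n
      unfolding g_def by (intro continuous_on_real_root continuous_on_id)
    show "g n (h n x) = x" for n x
      unfolding g_def h_def by (rule odd_real_root_power_cancel) simp
    show "h n (g n x) = x" for n x
      unfolding g_def h_def by (rule odd_real_root_pow) simp
    show "\<bar>g n x\<bar> \<le> 1" "\<bar>g n x\<bar> < 1 \<longleftrightarrow> \<bar>x\<bar> < 1" if "\<bar>x\<bar> \<le> 1" for n x
      using that by (simp_all add: root_abs)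
    show "\<bar>h n x\<bar> \<le> 1" "\<bar>h n x\<bar> < 1 \<longleftrightarrow> \<bar>x\<bar> < 1" if "\<bar>x\<bar> \<le> 1" for n x
      using that unfolding h_def power_abs by (simp_all add: power_le_one power_less_one_iff del: power_Suc)
  qed
  then obtain F F' where F: "homeomorphism C C F F'"
    and F_eq: "\<And>\<theta> t y. \<theta> \<in> cube \<Longrightarrow> t \<in> C \<Longrightarrow> y \<in> C \<Longrightarrow> \<forall>n. param n \<theta> t \<Longrightarrow>
      \<forall>n. param n (\<lambda>n. g n (\<theta> n)) y \<Longrightarrow> F t = y"
    by blast
  obtain D' where D: "homeomorphism C K dilate D'"
    using homeomorphism_dilate by blast
  have D_inv: "D' (dilate t) = t" if "t \<in> C" for t
    using D that by (simp add: homeomorphism_def)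
  define f where "f = dilate \<circ> (F \<circ> D')"
  have f_dilate: "f (dilate t) = dilate (F t)" if "t \<in> C" for t
    using D_inv[OF that] by (simp add: f_def)
  have "\<exists>f'. homeomorphism K K f f'"
    unfolding f_def using homeomorphism_compose[OF homeomorphism_compose[OF homeomorphism_symD[OF D] F] D]
    by (auto simp: o_assoc)
  moreover have "F (\<lambda>_. 0) = (\<lambda>_. 0)"
    by (rule F_eq[of "\<lambda>_. 0"]) (auto simp: cube_def zero_in_C param_def lo_zero g_def)
  then have "f (\<lambda>_. 0) = (\<lambda>_. 0)"
    using f_dilate[OF zero_in_C] by (simp add: dilate_def)
  moreover have "\<exists>w\<in>K. (\<lambda>n. \<epsilon> * w n) \<in> K \<and> (\<forall>c\<in>K. f (\<lambda>n. \<epsilon> * w n) \<noteq> (\<lambda>n. c n / 4))" if eps: "\<epsilon> > 0" for \<epsilon> :: real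
  proof -
    obtain n where n: "(3/4::real) ^ n < \<epsilon> / 2"
      using real_arch_pow_inv[of "\<epsilon> / 2" "3/4"] eps by auto
    \<comment> \<open>The root of order \<open>2 * n + 1\<close> takes \<open>p\<close> to 3/4. The
      margin \<open>2 * p \<le> \<epsilon>\<close> absorbs the factor
      \<open>1 / (1 - wsq z) \<le> 2\<close> from \<open>dilate\<close>.\<close>
    define p where "p = (3/4::real) ^ (2 * n + 1)"
    have "p \<le> (3/4) ^ n"
      unfolding p_def by (intro power_decreasing) auto
    moreover have "p \<le> 1"
      unfolding p_def by (rule power_le_one) auto
    ultimately have p: "0 < p" "p \<le> 1" "2 * p \<le> \<epsilon>"
      using n by (auto simp: p_def power_le_one)
    define l where "l = hi n (\<lambda>_. 0)"
    have l: "0 < l"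
      unfolding l_def by (rule hi_zero_pos)
    \<comment> \<open>\<open>u\<close> has the largest coordinate \<open>n\<close> among the points
      of \<open>C\<close> that vanish before \<open>n\<close>. Its multiple \<open>z = p * u\<close>
      therefore has relative coordinates 0 before \<open>n\<close> and \<open>p\<close> at
      \<open>n\<close>.\<close>
    obtain u where u: "u \<in> fiber n (\<lambda>_. 0)" "u n = l"
      using hi_attained[of n "\<lambda>_. 0"] fiber_refl[OF zero_in_C, of n] by (auto simp: l_def)
    then have uC: "u \<in> C" and u0: "\<And>k. k < n \<Longrightarrow> u k = 0"
      by (auto simp: fiber_def)
    define z where "z = (\<lambda>k. p * u k)"
    have z: "z \<in> C"
      using C_mix(1)[OF zero_in_C uC, of p] p by (simp add: z_def)
    obtain \<theta> where \<theta>: "\<theta> \<in> cube" "\<forall>n. param n \<theta> z"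
      using ex_param_value[OF z] by blast
    have "(\<lambda>n. g n (\<theta> n)) \<in> cube"
      using \<theta>(1) real_root_abs[symmetric] by (auto simp: cube_def g_def)
    then obtain y where y: "y \<in> C" "\<forall>n. param n (\<lambda>n. g n (\<theta> n)) y"
      using ex_param_point by blast
    have Fz: "F z = y"
      using F_eq[OF \<theta>(1) z y(1) \<theta>(2) y(2)] .
    have \<theta>z: "2 * z k = \<theta> k * (2 * hi k (\<lambda>_. 0))" if "k \<le> n" for k
    proof -
      have "hi k z = hi k (\<lambda>_. 0)" "lo k z = lo k (\<lambda>_. 0)"
        using that u0 by (auto intro!: hi_cong lo_cong simp: z_def)
      then show ?thesis
        using spec[OF \<theta>(2), of k] by (simp add: param_def lo_zero)
    qed
    have y0: "y k = 0" if "k < n" for k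
      using that
    proof (induction k rule: less_induct)
      case (less k)
      have "hi k y = hi k (\<lambda>_. 0)" "lo k y = lo k (\<lambda>_. 0)"
        using less by (auto intro!: hi_cong lo_cong)
      moreover have "\<theta> k = 0"
        using \<theta>z[of k] less.prems u0[of k] hi_zero_pos[of k] by (simp add: z_def)
      ultimately show ?case
        using spec[OF y(2), of k] by (simp add: param_def lo_zero g_def)
    qed
    have "\<theta> n = p"
      using \<theta>z[of n] l u(2) by (simp add: z_def l_def)
    then have "g n (\<theta> n) = 3/4"
      by (simp add: g_def p_def odd_real_root_power_cancel del: power_Suc)
    moreover have "hi n y = l" "lo n y = - l"
      using y0 hi_cong[of n y "\<lambda>_. 0"] lo_cong[of n y "\<lambda>_. 0"] by (auto simp: l_def lo_zero)
    ultimately have yn: "y n = 3/4 * l"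
      using spec[OF y(2), of n] by (simp add: param_def)
    \<comment> \<open>Chosen so that \<open>\<epsilon> * w\<close> is \<open>dilate z\<close>; its
      factor is at most 1 because
      \<open>p \<le> \<epsilon> / 2 \<le> \<epsilon> * (1 - wsq z)\<close>.\<close>
    define w where "w = (\<lambda>k. p / (\<epsilon> * (1 - wsq z)) * u k)"
    have wz: "1/2 \<le> 1 - wsq z"
      using wsq_cube_le[OF C_cube[OF z]] by simp
    then have "\<epsilon> * (1/2) \<le> \<epsilon> * (1 - wsq z)"
      using eps by (intro mult_left_mono) auto
    then have "p \<le> \<epsilon> * (1 - wsq z)"
      using p by linarith
    moreover from this have "0 < \<epsilon> * (1 - wsq z)"
      using p by linarith
    ultimately have "\<bar>p / (\<epsilon> * (1 - wsq z))\<bar> \<le> 1"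
      using p by simp
    then have "w \<in> K"
      unfolding w_def by (intro K_scale C_subset_K uC)
    moreover have eq: "(\<lambda>k. \<epsilon> * w k) = dilate z"
      using that by (simp add: w_def z_def dilate_def)
    moreover have "dilate z \<in> K"
      using D z by (auto simp: homeomorphism_def)
    moreover have "f (dilate z) \<noteq> (\<lambda>n. c n / 4)" if c: "c \<in> K" for c
    proof
      assume "f (dilate z) = (\<lambda>n. c n / 4)"
      then have "dilate y = (\<lambda>n. c n / 4)"
        using f_dilate[OF z] Fz by simp
      then have yc: "y k / (1 - wsq y) = c k / 4" for k
        by (auto simp: dilate_def dest: fun_cong)
      have wy: "1/2 \<le> 1 - wsq y" "1 - wsq y \<le> 1"
        using wsq_cube_le[OF C_cube[OF y(1)]] wsq_cube_nonneg[OF C_cube[OF y(1)]] by auto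
      \<comment> \<open>If \<open>dilate y\<close> were in \<open>K / 4\<close>, the gauge of
        \<open>3/2 * y\<close> would be at most \<open>r \<le> 3/8\<close>, below the bound 1/2 that
        guarantees membership in \<open>C\<close>. But its coordinate \<open>n\<close> is
        \<open>9/8 * l\<close>, beyond the maximum \<open>l\<close>.\<close>
      define r where "r = 3/8 * (1 - wsq y)"
      have r: "0 \<le> r" "r \<le> 3/8"
        using wy by (auto simp: r_def)
      have rc: "3/2 * y k = r * c k" for k
        using yc[of k] wy by (simp add: r_def field_simps)
      have "\<bar>c n\<bar> \<le> 1" for n
        using c K_cube cubeD by blast
      then have "\<bar>3/2 * y k\<bar> \<le> 1" for k
        unfolding rc using r by (simp add: abs_mult mult_le_one)
      then have "wsq (\<lambda>k. 3/2 * y k) \<le> 1/2"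
        by (rule wsq_le)
      then have "(\<lambda>k. 3/2 * y k) \<in> C"
        using r rc by (intro C_I[OF c r(1)]) auto
      then have "(\<lambda>k. 3/2 * y k) \<in> fiber n (\<lambda>_. 0)"
        using y0 by (simp add: fiber_def)
      from hi_max[OF this] show False
        using yn l by (simp add: l_def)
    qed
    ultimately show ?thesis
      by (intro bexI[of _ w]) auto
  qed
  ultimately show ?thesis
    by blast
qed

end

subsection \<open>Hahn--Banach via minimal sublinear functionals\<close>

definition sublinear :: "('a::real_vector \<Rightarrow> real) \<Rightarrow> bool"
  where "sublinear p \<longleftrightarrow> (\<forall>x y. p (x + y) \<le> p x + p y) \<and> (\<forall>r\<ge>0. \<forall>x. p (r *\<^sub>R x) \<le> r * p x)"

lemma sublinear_add: "sublinear p \<Longrightarrow> p (x + y) \<le> p x + p y"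
  by (simp add: sublinear_def)

lemma sublinear_zero: "sublinear p \<Longrightarrow> p 0 = 0"
  unfolding sublinear_def by (metis add.right_neutral add_le_same_cancel1 antisym mult_zero_left order_refl scaleR_zero_left le_add_same_cancel1)

text \<open>For \<open>r > 0\<close> the reverse inequality is the defining one for
  \<open>1 / r\<close> at the point \<open>r *\<^sub>R x\<close>.\<close>

lemma sublinear_scale:
  assumes "sublinear p" "0 \<le> r"
  shows "p (r *\<^sub>R x) = r * p x"
proof (cases "r = 0")
  case True
  then show ?thesis using sublinear_zero[OF assms(1)] by simp
next
  case False
  then have "p ((1 / r) *\<^sub>R (r *\<^sub>R x)) \<le> (1 / r) * p (r *\<^sub>R x)"
    using assms unfolding sublinear_def by (meson zero_le_divide_1_iff)
  then have "r * p x \<le> p (r *\<^sub>R x)"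
    using False assms(2) by (simp add: field_simps)
  moreover have "p (r *\<^sub>R x) \<le> r * p x"
    using assms by (simp add: sublinear_def)
  ultimately show ?thesis
    by simp
qed

lemma sublinear_lower: "sublinear p \<Longrightarrow> - p (- x) \<le> p x"
  using sublinear_add[of p x "- x"] sublinear_zero[of p] by simp

text \<open>The largest candidate below \<open>p\<close> that can decrease at full rate
  \<open>p y\<close> along \<open>- y\<close>: taking \<open>t = 1\<close> gives
  \<open>tilt p y (- y) \<le> - p y\<close>, while \<open>t = 0\<close> gives
  \<open>tilt p y \<le> p\<close>.\<close>

definition tilt :: "('a::real_vector \<Rightarrow> real) \<Rightarrow> 'a \<Rightarrow> 'a \<Rightarrow> real"
  where "tilt p y x = (INF t\<in>{0..}. p (x + t *\<^sub>R y) - t * p y)"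

lemma tilt_le:
  assumes p: "sublinear p" and "0 \<le> t"
  shows "tilt p y x \<le> p (x + t *\<^sub>R y) - t * p y"
  unfolding tilt_def
proof (rule cINF_lower)
  \<comment> \<open>Subadditivity gives a lower bound independent of \<open>t\<close>, so the
    infimum is a genuine one.\<close>
  have "- p (- x) \<le> p (x + t *\<^sub>R y) - t * p y" if "0 \<le> t" for t
    using sublinear_add[OF p, of "x + t *\<^sub>R y" "- x"] sublinear_scale[OF p that, of y] by simp
  then show "bdd_below ((\<lambda>t. p (x + t *\<^sub>R y) - t * p y) ` {0..})"
    by (intro bdd_belowI2) auto
qed (use assms in simp)

lemma tilt_greatest:
  "(\<And>t. 0 \<le> t \<Longrightarrow> c \<le> p (x + t *\<^sub>R y) - t * p y) \<Longrightarrow> c \<le> tilt p y x"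
  unfolding tilt_def by (intro cINF_greatest) auto

text \<open>For sums the parameters \<open>t\<close> and \<open>t'\<close> are added, for multiples
  \<open>t\<close> is rescaled to \<open>r * t\<close>.\<close>

lemma sublinear_tilt:
  assumes p: "sublinear p"
  shows "sublinear (tilt p y)"
  unfolding sublinear_def
proof (intro conjI allI impI)
  fix x x'
  have "tilt p y (x + x') - (p (x' + t' *\<^sub>R y) - t' * p y) \<le> tilt p y x" if t': "0 \<le> t'" for t'
  proof (rule tilt_greatest)
    fix t :: real assume "0 \<le> t"
    have "tilt p y (x + x') \<le> p (x + x' + (t + t') *\<^sub>R y) - (t + t') * p y"
      using \<open>0 \<le> t\<close> t' by (intro tilt_le[OF p]) simp
    also have "x + x' + (t + t') *\<^sub>R y = (x + t *\<^sub>R y) + (x' + t' *\<^sub>R y)"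
      by (simp add: scaleR_add_left)
    finally show "tilt p y (x + x') - (p (x' + t' *\<^sub>R y) - t' * p y) \<le> p (x + t *\<^sub>R y) - t * p y"
      using sublinear_add[OF p, of "x + t *\<^sub>R y" "x' + t' *\<^sub>R y"] by (simp add: distrib_right)
  qed
  then have "tilt p y (x + x') - tilt p y x \<le> tilt p y x'"
    by (intro tilt_greatest) (simp add: algebra_simps)
  then show "tilt p y (x + x') \<le> tilt p y x + tilt p y x'"
    by simp
next
  fix r :: real and x assume r: "0 \<le> r"
  show "tilt p y (r *\<^sub>R x) \<le> r * tilt p y x"
  proof (cases "r = 0")
    case True
    then show ?thesis
      using tilt_le[OF p, of 0 y 0] sublinear_zero[OF p] by simp
  next
    case False
    have "tilt p y (r *\<^sub>R x) / r \<le> tilt p y x"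
    proof (rule tilt_greatest)
      fix t :: real assume t: "0 \<le> t"
      have "tilt p y (r *\<^sub>R x) \<le> p (r *\<^sub>R x + (r * t) *\<^sub>R y) - r * t * p y"
        using r t by (intro tilt_le[OF p]) simp
      also have "r *\<^sub>R x + (r * t) *\<^sub>R y = r *\<^sub>R (x + t *\<^sub>R y)"
        by (simp add: scaleR_add_right)
      finally have "tilt p y (r *\<^sub>R x) \<le> r * (p (x + t *\<^sub>R y) - t * p y)"
        by (simp add: sublinear_scale[OF p r] right_diff_distrib)
      then show "tilt p y (r *\<^sub>R x) / r \<le> p (x + t *\<^sub>R y) - t * p y"
        using r False by (simp add: divide_le_eq mult.commute)
    qed
    then show ?thesis
      using r False by (simp add: divide_le_eq mult.commute)
  qed
qed

text \<open>Zorn's lemma for the reversed pointwise order. A chain has its pointwise infimum as a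
  bound: it is finite because all members dominate \<open>- p (- x)\<close>, and subadditive because
  two members can be replaced by the smaller one.\<close>

lemma ex_minimal_sublinear:
  fixes p :: "'a::real_vector \<Rightarrow> real"
  assumes p: "sublinear p"
  shows "\<exists>m. sublinear m \<and> m \<le> p \<and> (\<forall>q. sublinear q \<and> q \<le> m \<longrightarrow> q = m)"
proof -
  define A where "A = {q. sublinear q \<and> q \<le> p}"
  have "\<exists>m\<in>A. \<forall>q\<in>A. q \<le> m \<longrightarrow> q = m"
  proof (rule predicate_Zorn[of A "\<lambda>q q'. q' \<le> q"])
    show "partial_order_on A (relation_of (\<lambda>q q'. q' \<le> q) A)"
      by (rule partial_order_on_relation_ofI) auto
    fix C assume C: "C \<in> Chains (relation_of (\<lambda>q q'. q' \<le> q) A)"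
    then have sub: "C \<subseteq> A" and total: "\<And>q q'. q \<in> C \<Longrightarrow> q' \<in> C \<Longrightarrow> q \<le> q' \<or> q' \<le> q"
      by (auto simp: Chains_def relation_of_def)
    show "\<exists>u\<in>A. \<forall>q\<in>C. u \<le> q"
    proof (cases "C = {}")
      case True
      then show ?thesis using p by (auto simp: A_def)
    next
      case False
      define u where "u x = (INF q\<in>C. q x)" for x
      have subl: "sublinear q" if "q \<in> C" for q
        using that sub by (auto simp: A_def)
      have "- p (- x) \<le> q x" if "q \<in> C" for q x
      proof -
        have "q (- x) \<le> p (- x)"
          using that sub by (auto simp: A_def le_fun_def)
        then show ?thesis
          using sublinear_lower[OF subl[OF that], of x] by simp
      qed
      then have "bdd_below ((\<lambda>q. q x) ` C)" for x
        by (intro bdd_belowI2) auto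
      then have lower: "u x \<le> q x" if "q \<in> C" for q x
        unfolding u_def using that by (intro cINF_lower) auto
      have greatest: "c \<le> u x" if "\<And>q. q \<in> C \<Longrightarrow> c \<le> q x" for c x
        unfolding u_def using False that by (intro cINF_greatest) auto
      have "sublinear u"
        unfolding sublinear_def
      proof (intro conjI allI impI)
        fix x y
        have *: "u (x + y) \<le> q x + q' y" if q: "q \<in> C" "q' \<in> C" for q q'
        proof -
          from total[OF q] obtain q0 where q0: "q0 \<in> C" "q0 \<le> q" "q0 \<le> q'"
            using q by blast
          have "u (x + y) \<le> q0 x + q0 y"
            using lower[OF q0(1), of "x + y"] sublinear_add[OF subl[OF q0(1)], of x y] by simp
          then show ?thesis
            using add_mono[OF le_funD[OF q0(2), of x] le_funD[OF q0(3), of y]] by linarith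
        qed
        have "u (x + y) - q' y \<le> u x" if "q' \<in> C" for q'
          using *[OF _ that] by (intro greatest) (simp add: diff_le_eq)
        then have "u (x + y) - u x \<le> u y"
          by (intro greatest) (simp add: algebra_simps)
        then show "u (x + y) \<le> u x + u y"
          by simp
      next
        fix r :: real and x assume r: "0 \<le> r"
        have *: "u (r *\<^sub>R x) \<le> r * q x" if "q \<in> C" for q
          using lower[OF that, of "r *\<^sub>R x"] sublinear_scale[OF subl[OF that] r] by simp
        show "u (r *\<^sub>R x) \<le> r * u x"
        proof (cases "r = 0")
          case True
          then show ?thesis using * False by auto
        next
          case False
          then have "u (r *\<^sub>R x) / r \<le> u x"
            using r * by (intro greatest) (simp add: divide_le_eq mult.commute)
          then show ?thesis
            using r False by (simp add: divide_le_eq mult.commute)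
        qed
      qed
      moreover obtain q0 where "q0 \<in> C"
        using False by blast
      then have "u \<le> q0" "q0 \<le> p"
        using lower sub by (auto simp: A_def intro: le_funI)
      then have "u \<le> p"
        by (rule order_trans)
      ultimately show ?thesis
        using lower by (auto simp: A_def le_fun_def)
    qed
  qed
  then obtain m where m: "m \<in> A" "\<forall>q\<in>A. q \<le> m \<longrightarrow> q = m"
    by blast
  have "q = m" if "sublinear q" "q \<le> m" for q
  proof -
    have "q \<in> A"
      using m(1) that by (auto simp: A_def)
    then show ?thesis
      using m(2) that(2) by blast
  qed
  then show ?thesis
    using m(1) by (auto simp: A_def)
qed

text \<open>A minimal sublinear \<open>m\<close> is linear: \<open>tilt m y\<close> lies below
  \<open>m\<close>, hence equals it, and \<open>t = 1\<close> yields
  \<open>m x + m y \<le> m (x + y)\<close>. Choosing \<open>m\<close> below \<open>tilt p z\<close>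
  forces \<open>m (- z) \<le> - p z\<close>.\<close>

lemma hahn_banach_sublinear:
  assumes p: "sublinear p"
  shows "\<exists>f. linear f \<and> (\<forall>x. f x \<le> p x) \<and> p z \<le> f z"
proof -
  obtain m where m: "sublinear m" "m \<le> tilt p z" "\<And>q. sublinear q \<Longrightarrow> q \<le> m \<Longrightarrow> q = m"
    using ex_minimal_sublinear[OF sublinear_tilt[OF p, of z]] by blast
  have add: "m (x + y) = m x + m y" for x y
  proof -
    have "tilt m y \<le> m"
      using tilt_le[OF m(1), of 0 y] by (simp add: le_fun_def)
    then have "tilt m y = m"
      using m(3) sublinear_tilt[OF m(1)] by blast
    then have "m x \<le> m (x + y) - m y"
      using tilt_le[OF m(1), of 1 y x] by simp
    then show ?thesis
      using sublinear_add[OF m(1), of x y] by simp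
  qed
  have neg: "m (- x) = - m x" for x
    using add[of x "- x"] sublinear_zero[OF m(1)] by simp
  have "m (r *\<^sub>R x) = r * m x" for r x
  proof (cases "0 \<le> r")
    case True
    then show ?thesis using sublinear_scale[OF m(1)] by blast
  next
    case False
    then have "m ((- r) *\<^sub>R x) = (- r) * m x"
      by (intro sublinear_scale[OF m(1)]) simp
    then show ?thesis
      using neg[of "r *\<^sub>R x"] by simp
  qed
  then have "linear m"
    using add by (intro linearI) auto
  moreover have "m x \<le> p x" for x
    using m(2) tilt_le[OF p, of 0 z x] by (auto simp: le_fun_def intro: order_trans)
  moreover have "m (- z) \<le> - p z"
    using m(2) tilt_le[OF p, of 1 z "- z"] sublinear_zero[OF p] by (auto simp: le_fun_def intro: order_trans)
  then have "p z \<le> m z"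
    using neg[of z] by simp
  ultimately show ?thesis
    by blast
qed

section \<open>Separation in normed spaces\<close>

lemma separating_functional:
  fixes M :: "'a::real_normed_vector set"
  assumes M: "subspace M" "closed M" and z: "z \<notin> M"
  shows "\<exists>f :: 'a \<Rightarrow>\<^sub>L real. (\<forall>x\<in>M. f x = 0) \<and> f z \<noteq> 0"
proof -
  have ne: "M \<noteq> {}"
    using subspace_0[OF M(1)] by blast
  have greatest: "c \<le> infdist x M" if "\<And>a. a \<in> M \<Longrightarrow> c \<le> norm (x - a)" for c and x :: 'a
    using that ne by (auto simp: infdist_def dist_norm intro!: cINF_greatest)
  have lower: "infdist x M \<le> norm (x - a)" if "a \<in> M" for x a :: 'a
    using infdist_le[OF that, of x] by (simp add: dist_norm)
  \<comment> \<open>Hahn-Banach is applied to the distance from \<open>M\<close>: it vanishes on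
    \<open>M\<close>, is bounded by the norm, and is positive at \<open>z\<close>, so a dominated
    linear functional with at least this value at \<open>z\<close> has all required
    properties.\<close>
  have "sublinear (\<lambda>x. infdist x M)"
    unfolding sublinear_def
  proof (intro conjI allI impI)
    fix x y :: 'a
    have *: "infdist (x + y) M \<le> norm (x - a) + norm (y - b)" if "a \<in> M" "b \<in> M" for a b
    proof -
      have "infdist (x + y) M \<le> norm ((x + y) - (a + b))"
        by (intro lower subspace_add[OF M(1)] that)
      then show ?thesis
        using norm_triangle_ineq[of "x - a" "y - b"] by (simp add: algebra_simps)
    qed
    have "infdist (x + y) M - norm (y - b) \<le> infdist x M" if "b \<in> M" for b
      using *[OF _ that] by (intro greatest) (simp add: diff_le_eq)
    then have "infdist (x + y) M - infdist x M \<le> infdist y M"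
      by (intro greatest) (simp add: algebra_simps)
    then show "infdist (x + y) M \<le> infdist x M + infdist y M"
      by simp
  next
    fix r :: real and x :: 'a assume r: "0 \<le> r"
    have *: "infdist (r *\<^sub>R x) M \<le> r * norm (x - a)" if "a \<in> M" for a
    proof -
      have "infdist (r *\<^sub>R x) M \<le> norm (r *\<^sub>R x - r *\<^sub>R a)"
        by (intro lower subspace_scale[OF M(1)] that)
      then show ?thesis
        using r by (simp add: scaleR_diff_right[symmetric])
    qed
    show "infdist (r *\<^sub>R x) M \<le> r * infdist x M"
    proof (cases "r = 0")
      case True
      then show ?thesis using *[OF subspace_0[OF M(1)]] by simp
    next
      case False
      then have "infdist (r *\<^sub>R x) M / r \<le> infdist x M"
        using r * by (intro greatest) (simp add: divide_le_eq mult.commute)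
      then show ?thesis
        using r False by (simp add: divide_le_eq mult.commute)
    qed
  qed
  from hahn_banach_sublinear[OF this, of z] obtain f
    where f: "linear f" "\<And>x. f x \<le> infdist x M" "infdist z M \<le> f z"
    by blast
  have le: "f x \<le> norm x" for x
    using f(2)[of x] lower[OF subspace_0[OF M(1)], of x] by simp
  have neg: "f (- x) = - f x" for x
    using linear_neg[OF f(1)] .
  have "norm (f x) \<le> norm x * 1" for x
    using le[of x] le[of "- x"] by (simp add: neg abs_le_iff)
  then have bl: "bounded_linear f"
    using f(1) by (intro bounded_linear_intro[where K = 1]) (auto simp: linear_add linear_scale)
  have "f x = 0" if "x \<in> M" for x
    using f(2)[of x] f(2)[of "- x"] that subspace_neg[OF M(1) that] by (simp add: neg)
  moreover have "f z \<noteq> 0"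
    using f(3) infdist_pos_not_in_closed[OF M(2) ne z] by simp
  ultimately show ?thesis
    by (intro exI[of _ "Blinfun f"]) (simp add: bounded_linear_Blinfun_apply[OF bl])
qed

text \<open>A functional that vanishes on \<open>span B\<close> but not at the new vector
  \<open>x\<close> reads off the coefficient of \<open>x\<close> continuously. The larger span is
  then the preimage of \<open>span B\<close> under subtraction of the
  \<open>x\<close>-component.\<close>

lemma closed_span_finite:
  fixes B :: "'a::real_normed_vector set"
  assumes "finite B"
  shows "closed (span B)"
  using assms
proof (induction B rule: finite_induct)
  case empty
  then show ?case by simp
next
  case (insert x B)
  show ?case
  proof (cases "x \<in> span B")
    case True
    then show ?thesis using insert.IH span_redundant by metis
  next
    case False
    obtain f :: "'a \<Rightarrow>\<^sub>L real" where f: "\<forall>y\<in>span B. f y = 0" "f x \<noteq> 0"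
      using separating_functional[OF subspace_span insert.IH False] by blast
    have "span (insert x B) = {y. y - (f y / f x) *\<^sub>R x \<in> span B}"
    proof (intro set_eqI iffI)
      fix y assume "y \<in> span (insert x B)"
      then obtain k where k: "y - k *\<^sub>R x \<in> span B"
        by (auto simp: span_breakdown_eq)
      then have "f (y - k *\<^sub>R x) = 0"
        using f(1) by blast
      then have "k = f y / f x"
        using f(2) by (simp add: blinfun.diff_right blinfun.scaleR_right field_simps)
      then show "y \<in> {y. y - (f y / f x) *\<^sub>R x \<in> span B}"
        using k by simp
    qed (auto simp: span_breakdown_eq)
    moreover have "continuous_on UNIV (\<lambda>y. y - (f y / f x) *\<^sub>R x)"
      by (intro continuous_intros) (simp add: f(2))
    then have "closed {y. y - (f y / f x) *\<^sub>R x \<in> span B}"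
      using closed_vimage[OF insert.IH, of "\<lambda>y. y - (f y / f x) *\<^sub>R x"] by (simp add: vimage_def)
    ultimately show ?thesis
      by simp
  qed
qed

lemma ex_separating_sequence:
  assumes inf_dim: "\<not> (\<exists>B :: 's::real_normed_vector set. finite B \<and> span B = UNIV)"
    and sep: "separable_space (euclidean :: 's topology)"
  shows "\<exists>x :: nat \<Rightarrow> 's. (\<forall>n. norm (x n) = 1) \<and>
    (\<forall>s :: 's \<Rightarrow>\<^sub>L real. (\<forall>n. blinfun_apply s (x n) = 0) \<longrightarrow> s = 0) \<and>
    (\<forall>n. \<exists>s :: 's \<Rightarrow>\<^sub>L real. (\<forall>j<n. blinfun_apply s (x j) = 0) \<and> blinfun_apply s (x n) \<noteq> 0)"
proof -
  obtain D :: "'s set" where D: "countable D" "closure D = UNIV"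
    using sep by (auto simp: separable_space_def)
  then have "D \<noteq> {}"
    by auto
  then obtain d :: "nat \<Rightarrow> 's" where d: "range d = D"
    using range_from_nat_into[OF _ D(1)] by blast
  \<comment> \<open>The indices at which the dense sequence leaves the closed span of its earlier
    terms, expressed through functionals.\<close>
  define J where "J = {n. \<exists>s :: 's \<Rightarrow>\<^sub>L real. (\<forall>j<n. blinfun_apply s (d j) = 0) \<and> blinfun_apply s (d n) \<noteq> 0}"
  \<comment> \<open>Strong induction: an index outside \<open>J\<close> adds no condition, so
    \<open>s\<close> vanishes on every \<open>d n\<close>, and by density everywhere.\<close>
  have kill: "s = 0" if s: "\<forall>n\<in>J. blinfun_apply s (d n) = 0" for s :: "'s \<Rightarrow>\<^sub>L real"
  proof -
    have "blinfun_apply s (d n) = 0" for n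
    proof (induction n rule: less_induct)
      case (less n)
      then show ?case
        using s unfolding J_def by blast
    qed
    then have "D \<subseteq> {x. blinfun_apply s x = 0}"
      using d by auto
    moreover have "closed {x. blinfun_apply s x = 0}"
      by (intro closed_Collect_eq continuous_intros)
    ultimately have "closure D \<subseteq> {x. blinfun_apply s x = 0}"
      by (rule closure_minimal)
    then show ?thesis
      using D(2) by (intro blinfun_eqI) auto
  qed
  \<comment> \<open>Otherwise the vectors indexed by \<open>J\<close> span a closed proper subspace,
    and a nonzero functional vanishing on it contradicts \<open>kill\<close>.\<close>
  have "infinite J"
  proof
    assume "finite J"
    then have fin: "finite (d ` J)"
      by simp
    then obtain z where "z \<notin> span (d ` J)"
      using inf_dim by blast
    then obtain f :: "'s \<Rightarrow>\<^sub>L real" where "\<forall>x\<in>span (d ` J). f x = 0" "f z \<noteq> 0"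
      using separating_functional[OF subspace_span closed_span_finite[OF fin]] by blast
    then show False
      using kill[of f] by (auto simp: span_base)
  qed
  define x where "x k = sgn (d (enumerate J k))" for k
  have J: "enumerate J k \<in> J" for k
    using enumerate_in_set[OF \<open>infinite J\<close>] .
  have d0: "d (enumerate J k) \<noteq> 0" for k
    using J[of k] by (auto simp: J_def)
  have s_x: "blinfun_apply s (x k) = 0 \<longleftrightarrow> blinfun_apply s (d (enumerate J k)) = 0" for s :: "'s \<Rightarrow>\<^sub>L real" and k
    using d0[of k] by (simp add: x_def sgn_div_norm blinfun.scaleR_right)
  show ?thesis
  proof (intro exI[of _ x] conjI allI impI)
    show "norm (x n) = 1" for n
      using d0 by (simp add: x_def norm_sgn)
    show "s = 0" if "\<forall>n. blinfun_apply s (x n) = 0" for s :: "'s \<Rightarrow>\<^sub>L real"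
    proof (rule kill, rule ballI)
      fix n assume "n \<in> J"
      then obtain k where "n = enumerate J k"
        using range_enumerate[OF \<open>infinite J\<close>] by blast
      then show "blinfun_apply s (d n) = 0"
        using that s_x by simp
    qed
    fix n
    obtain s :: "'s \<Rightarrow>\<^sub>L real" where "\<forall>j<enumerate J n. blinfun_apply s (d j) = 0" "blinfun_apply s (d (enumerate J n)) \<noteq> 0"
      using J[of n] by (auto simp: J_def)
    then show "\<exists>s :: 's \<Rightarrow>\<^sub>L real. (\<forall>j<n. blinfun_apply s (x j) = 0) \<and> blinfun_apply s (x n) \<noteq> 0"
      using s_x enumerate_mono[OF _ \<open>infinite J\<close>] by blast
  qed
qed

subsection \<open>The dual ball\<close>

text \<open>Banach-Alaoglu: the linear functions bounded by the norm form a closed subset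
  \<open>L\<close> of a product of compact intervals, and \<open>Blinfun\<close> maps
  \<open>L\<close> continuously onto the ball.\<close>

lemma compact_space_weak_star_ball:
  "compact_space (weak_star_ball :: ('a::real_normed_vector \<Rightarrow>\<^sub>L real) topology)"
proof -
  define L where "L = PiE UNIV (\<lambda>x :: 'a. {- norm x..norm x}) \<inter>
    ((\<Inter>x. \<Inter>y. {\<phi>. \<phi> (x + y) = \<phi> x + \<phi> y}) \<inter> (\<Inter>r. \<Inter>x. {\<phi>. \<phi> (r *\<^sub>R x) = r * \<phi> x}))"
  have "compactin (product_topology (\<lambda>_. euclidean) UNIV) (PiE UNIV (\<lambda>x :: 'a. {- norm x..norm x}))"
    by (simp add: compactin_PiE)
  moreover have coord: "continuous_on UNIV (\<lambda>\<phi> :: 'a \<Rightarrow> real. \<phi> x)" for x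
    by (rule continuous_on_coordinate)
  have "closed {\<phi> :: 'a \<Rightarrow> real. \<phi> (x + y) = \<phi> x + \<phi> y}" for x y
    by (intro closed_Collect_eq continuous_on_add coord)
  moreover have "closed {\<phi> :: 'a \<Rightarrow> real. \<phi> (r *\<^sub>R x) = r * \<phi> x}" for r x
    by (intro closed_Collect_eq continuous_on_mult continuous_on_const coord)
  ultimately have L: "compact L"
    unfolding L_def by (intro compact_Int_closed closed_Int closed_INT ballI)
      (auto simp: euclidean_product_topology)
  have bl: "bounded_linear \<phi>" and bound: "\<bar>\<phi> x\<bar> \<le> norm x" if "\<phi> \<in> L" for \<phi> x
  proof -
    have bound: "\<bar>\<phi> x\<bar> \<le> norm x" for x
      using that by (auto simp: L_def abs_le_iff PiE_iff minus_le_iff)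
    show "\<bar>\<phi> x\<bar> \<le> norm x"
      by (rule bound)
    show "bounded_linear \<phi>"
      by (rule bounded_linear_intro[where K = 1]) (use that bound in \<open>auto simp: L_def\<close>)
  qed
  have apply_B: "blinfun_apply (Blinfun \<phi>) = \<phi>" if "\<phi> \<in> L" for \<phi>
    using bounded_linear_Blinfun_apply[OF bl[OF that]] .
  have "continuous_map (subtopology euclidean L) weak_star_topology Blinfun"
    unfolding continuous_on_strong_operator_topo_iff_coordinatewise
  proof
    fix x
    have "continuous_map (subtopology euclidean L) euclidean (\<lambda>\<phi>. \<phi> x)"
      using continuous_on_coordinate[of L x] by simp
    then show "continuous_map (subtopology euclidean L) euclidean (\<lambda>\<phi>. blinfun_apply (Blinfun \<phi>) x)"
      by (rule continuous_map_eq) (simp add: apply_B)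
  qed
  moreover have "compactin (subtopology euclidean L) L"
    using L by (simp add: compactin_subtopology)
  ultimately have "compactin weak_star_topology (Blinfun ` L)"
    by (rule image_compactin[rotated])
  moreover have "Blinfun ` L = cball 0 1"
  proof (intro equalityI subsetI)
    fix s assume "s \<in> Blinfun ` L"
    then obtain \<phi> where "\<phi> \<in> L" "s = Blinfun \<phi>"
      by blast
    then show "s \<in> cball 0 1"
      using bound apply_B by (auto intro!: norm_blinfun_bound)
  next
    fix s :: "'a \<Rightarrow>\<^sub>L real" assume s: "s \<in> cball 0 1"
    have "\<bar>blinfun_apply s x\<bar> \<le> norm x" for x
      using norm_blinfun[of s x] s mult_right_mono[of "norm s" 1 "norm x"] by simp
    then have "blinfun_apply s \<in> L"
      by (auto simp: L_def abs_le_iff minus_le_iff blinfun.add_right blinfun.scaleR_right)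
    then show "s \<in> Blinfun ` L"
      by (metis blinfun_apply_inverse image_eqI)
  qed
  ultimately show ?thesis
    by (simp add: compact_space_subtopology)
qed

lemma topspace_weak_star_ball: "topspace weak_star_ball = cball 0 1"
  by (simp add: strong_operator_topology_topspace)

lemma continuous_map_weak_star_ball_eval: "continuous_map weak_star_ball euclidean (\<lambda>s. blinfun_apply s x)"
  by (intro continuous_map_from_subtopology strong_operator_topology_continuous_evaluation)

text \<open>Evaluation at the separating sequence is a continuous injection of the compact ball, so
  a homeomorphism onto \<open>K\<close>. It carries the dual norm to the gauge of \<open>K\<close>,
  and \<open>ex_wild_homeomorphism\<close> is pulled back.\<close>

lemma ex_wild_dual_ball_homeomorphism:
  assumes inf_dim: "\<not> (\<exists>B :: 's::real_normed_vector set. finite B \<and> span B = UNIV)"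
    and sep: "separable_space (euclidean :: 's topology)"
  shows "\<exists>(g :: ('s \<Rightarrow>\<^sub>L real) \<Rightarrow> 's \<Rightarrow>\<^sub>L real) g'. homeomorphic_maps weak_star_ball weak_star_ball g g' \<and> g 0 = 0 \<and>
    (\<forall>\<epsilon>>0. \<exists>s. norm s \<le> 1 \<and> norm s \<le> \<epsilon> \<and> 1/4 < norm (g s))"
proof -
  obtain x :: "nat \<Rightarrow> 's" where x: "\<And>n. norm (x n) = 1"
    and kill: "\<And>s :: 's \<Rightarrow>\<^sub>L real. \<forall>n. blinfun_apply s (x n) = 0 \<Longrightarrow> s = 0"
    and basis: "\<And>n. \<exists>s :: 's \<Rightarrow>\<^sub>L real. (\<forall>j<n. blinfun_apply s (x j) = 0) \<and> blinfun_apply s (x n) \<noteq> 0"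
    using ex_separating_sequence[OF assms] by blast
  define \<Phi> where "\<Phi> s = (\<lambda>n. blinfun_apply s (x n))" for s :: "'s \<Rightarrow>\<^sub>L real"
  define K where "K = \<Phi> ` cball 0 1"
  have cont: "continuous_map weak_star_ball euclidean \<Phi>"
  proof -
    have "continuous_map weak_star_ball (product_topology (\<lambda>_. euclidean) UNIV) \<Phi>"
      unfolding continuous_map_componentwise_UNIV \<Phi>_def
      using continuous_map_weak_star_ball_eval by blast
    then show ?thesis
      by (simp add: euclidean_product_topology)
  qed
  have inj: "s = t" if "\<Phi> s = \<Phi> t" for s t
  proof -
    have "\<forall>n. blinfun_apply (s - t) (x n) = 0"
      using that by (auto simp: \<Phi>_def blinfun.diff_left dest: fun_cong)
    then show ?thesis
      using kill[of "s - t"] by simp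
  qed
  interpret sequence_body K
  proof
    have "compactin euclidean (\<Phi> ` cball 0 1)"
      using image_compactin[OF _ cont] compact_space_weak_star_ball
      by (metis compact_space_def topspace_weak_star_ball)
    then show "compact K"
      by (simp add: K_def)
    show "K \<subseteq> cube"
    proof
      fix t assume "t \<in> K"
      then obtain s where s: "norm s \<le> 1" "t = \<Phi> s"
        by (auto simp: K_def)
      have "norm (blinfun_apply s (x n)) \<le> norm s * norm (x n)" for n
        by (rule norm_blinfun)
      then have "\<bar>t n\<bar> \<le> norm s" for n
        using s(2) x by (simp add: \<Phi>_def)
      then show "t \<in> cube"
        using s(1) by (auto simp: cube_def intro: order_trans)
    qed
    fix u v a b assume "u \<in> K" "v \<in> K" and ab: "\<bar>a\<bar> + \<bar>b\<bar> \<le> (1::real)"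
    then obtain s t where st: "norm s \<le> 1" "u = \<Phi> s" "norm t \<le> 1" "v = \<Phi> t"
      by (auto simp: K_def)
    have "norm (a *\<^sub>R s + b *\<^sub>R t) \<le> \<bar>a\<bar> * norm s + \<bar>b\<bar> * norm t"
      using norm_triangle_ineq[of "a *\<^sub>R s" "b *\<^sub>R t"] by simp
    also have "\<dots> \<le> \<bar>a\<bar> * 1 + \<bar>b\<bar> * 1"
      using st by (intro add_mono mult_left_mono) auto
    finally have "a *\<^sub>R s + b *\<^sub>R t \<in> cball 0 1"
      using ab by simp
    moreover have "\<Phi> (a *\<^sub>R s + b *\<^sub>R t) = (\<lambda>n. a * u n + b * v n)"
      by (simp add: st \<Phi>_def blinfun.add_left blinfun.scaleR_left)
    ultimately show "(\<lambda>n. a * u n + b * v n) \<in> K"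
      unfolding K_def by (metis image_eqI)
  next
    fix n
    obtain s :: "'s \<Rightarrow>\<^sub>L real" where s: "\<forall>j<n. blinfun_apply s (x j) = 0" "blinfun_apply s (x n) \<noteq> 0"
      using basis by blast
    \<comment> \<open>Normalised to the unit ball, with the sign that makes the value at
      \<open>x n\<close> positive.\<close>
    define e where "e = (sgn (blinfun_apply s (x n)) / norm s) *\<^sub>R s"
    have s0: "norm s > 0"
      using s(2) by (cases "s = 0") auto
    have "norm e \<le> 1"
      using s0 s(2) by (simp add: e_def abs_sgn_eq)
    then have "\<Phi> e \<in> K"
      by (auto simp: K_def)
    moreover have "\<Phi> e n = \<bar>blinfun_apply s (x n)\<bar> / norm s"
      by (simp add: \<Phi>_def e_def blinfun.scaleR_left abs_sgn mult.commute)
    then have "0 < \<Phi> e n"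
      using s0 s(2) by simp
    moreover have "\<forall>j<n. \<Phi> e j = 0"
      using s(1) by (simp add: \<Phi>_def e_def blinfun.scaleR_left)
    ultimately show "\<exists>e\<in>K. (\<forall>j<n. e j = 0) \<and> 0 < e n"
      by blast
  qed
  obtain f f' where f: "homeomorphism K K f f'" "f (\<lambda>_. 0) = (\<lambda>_. 0)"
    and wild: "\<And>\<epsilon>. 0 < \<epsilon> \<Longrightarrow> \<exists>w\<in>K. (\<lambda>n. \<epsilon> * w n) \<in> K \<and> (\<forall>c\<in>K. f (\<lambda>n. \<epsilon> * w n) \<noteq> (\<lambda>n. c n / 4))"
    using ex_wild_homeomorphism by blast
  have "homeomorphic_map weak_star_ball (subtopology euclidean K) \<Phi>"
  proof (rule continuous_imp_homeomorphic_map)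
    show "continuous_map weak_star_ball (subtopology euclidean K) \<Phi>"
      using cont unfolding continuous_map_in_subtopology topspace_weak_star_ball by (auto simp: K_def)
    show "Hausdorff_space (subtopology euclidean K)"
      by (intro Hausdorff_space_subtopology) simp
    show "inj_on \<Phi> (topspace weak_star_ball)"
      using inj by (auto simp: inj_on_def)
    show "\<Phi> ` topspace weak_star_ball = topspace (subtopology euclidean K)"
      unfolding topspace_weak_star_ball by (simp add: K_def)
  qed (rule compact_space_weak_star_ball)
  then obtain \<Psi> where \<Psi>: "homeomorphic_maps weak_star_ball (subtopology euclidean K) \<Phi> \<Psi>"
    by (auto simp: homeomorphic_map_maps)
  have f_maps: "homeomorphic_maps (subtopology euclidean K) (subtopology euclidean K) f f'"
    using f(1) by (auto simp: homeomorphic_maps_def homeomorphism_def continuous_map_in_subtopology)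
  define g where "g = \<Psi> \<circ> (f \<circ> \<Phi>)"
  have "homeomorphic_maps weak_star_ball (subtopology euclidean K) (f \<circ> \<Phi>) (\<Psi> \<circ> f')"
    using homeomorphic_maps_compose[OF conjI[OF \<Psi> f_maps]] .
  moreover have "homeomorphic_maps (subtopology euclidean K) weak_star_ball \<Psi> \<Phi>"
    using \<Psi> by (rule homeomorphic_maps_sym[THEN iffD1])
  ultimately have g: "homeomorphic_maps weak_star_ball weak_star_ball g (\<Psi> \<circ> f' \<circ> \<Phi>)"
    unfolding g_def by (metis homeomorphic_maps_compose)
  have \<Phi>_g: "\<Phi> (g s) = f (\<Phi> s)" if "norm s \<le> 1" for s
  proof -
    have "f (\<Phi> s) \<in> K"
      using f(1) that by (auto simp: homeomorphism_def K_def)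
    then show ?thesis
      using \<Psi> by (auto simp: g_def homeomorphic_maps_def)
  qed
  have \<Phi>_0: "\<Phi> 0 = (\<lambda>_. 0)"
    by (simp add: \<Phi>_def)
  have "g 0 = 0"
    using \<Phi>_g[of 0] f(2) by (intro inj) (simp add: \<Phi>_0)
  moreover have "\<exists>s. norm s \<le> 1 \<and> norm s \<le> \<epsilon> \<and> 1/4 < norm (g s)" if eps: "0 < \<epsilon>" for \<epsilon> :: real
  proof -
    define \<delta> where "\<delta> = min \<epsilon> 1"
    have \<delta>: "0 < \<delta>" "\<delta> \<le> \<epsilon>" "\<delta> \<le> 1"
      using eps by (auto simp: \<delta>_def)
    obtain w where w: "w \<in> K" "\<forall>c\<in>K. f (\<lambda>n. \<delta> * w n) \<noteq> (\<lambda>n. c n / 4)"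
      using wild[OF \<delta>(1)] by blast
    obtain s where s: "norm s \<le> 1" "w = \<Phi> s"
      using w(1) by (auto simp: K_def)
    have le: "norm (\<delta> *\<^sub>R s) \<le> \<delta>"
      using s(1) \<delta> by (simp add: mult_left_le)
    have \<Phi>s: "\<Phi> (\<delta> *\<^sub>R s) = (\<lambda>n. \<delta> * w n)"
      by (simp add: s \<Phi>_def blinfun.scaleR_left)
    \<comment> \<open>A norm of at most 1/4 would put four times the image in the unit ball, and
      hence the image sequence in \<open>K / 4\<close>.\<close>
    have "\<not> norm (g (\<delta> *\<^sub>R s)) \<le> 1/4"
    proof
      assume "norm (g (\<delta> *\<^sub>R s)) \<le> 1/4"
      then have "\<Phi> (4 *\<^sub>R g (\<delta> *\<^sub>R s)) \<in> K"
        unfolding K_def by (intro imageI) simp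
      moreover have "f (\<lambda>n. \<delta> * w n) = (\<lambda>n. \<Phi> (4 *\<^sub>R g (\<delta> *\<^sub>R s)) n / 4)"
        using \<Phi>_g[OF order_trans[OF le \<delta>(3)]] by (simp add: \<Phi>s[symmetric]) (simp add: \<Phi>_def blinfun.scaleR_left)
      ultimately show False
        using w(2) by blast
    qed
    moreover have "norm (\<delta> *\<^sub>R s) \<le> 1" "norm (\<delta> *\<^sub>R s) \<le> \<epsilon>"
      using le \<delta> by linarith+
    ultimately show ?thesis
      by (intro exI[of _ "\<delta> *\<^sub>R s"]) simp
  qed
  ultimately show ?thesis
    using g by blast
qed

section \<open>The dual of an l1-sum\<close>

lift_definition l1_inl :: "'a::real_normed_vector \<Rightarrow>\<^sub>L ('a, 'b::real_normed_vector) l1_sum"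
  is "\<lambda>a. L1_Pair a 0"
  by (rule bounded_linear_intro[where K = 1]) (auto simp: l1_sum_eq_iff norm_l1_sum_def)

lift_definition l1_inr :: "'b::real_normed_vector \<Rightarrow>\<^sub>L ('a::real_normed_vector, 'b) l1_sum"
  is "\<lambda>b. L1_Pair 0 b"
  by (rule bounded_linear_intro[where K = 1]) (auto simp: l1_sum_eq_iff norm_l1_sum_def)

text \<open>A functional on the sum is a pair of functionals, recovered by composition with
  \<open>l1_inl\<close> and \<open>l1_inr\<close>.\<close>

lift_definition l1_case :: "('a::real_normed_vector \<Rightarrow>\<^sub>L real) \<Rightarrow> ('b::real_normed_vector \<Rightarrow>\<^sub>L real) \<Rightarrow>
    ('a, 'b) l1_sum \<Rightarrow>\<^sub>L real"
  is "\<lambda>s t x. s (l1_fst x) + t (l1_snd x)"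
proof -
  fix s :: "'a \<Rightarrow> real" and t :: "'b \<Rightarrow> real"
  assume bl: "bounded_linear s" "bounded_linear t"
  have "bounded_linear (l1_fst :: ('a, 'b) l1_sum \<Rightarrow> 'a)" "bounded_linear (l1_snd :: ('a, 'b) l1_sum \<Rightarrow> 'b)"
    by (rule bounded_linear_intro[where K = 1]; auto simp: norm_l1_sum_def)+
  then show "bounded_linear (\<lambda>x. s (l1_fst x) + t (l1_snd x))"
    by (intro bounded_linear_add bounded_linear_compose[OF bl(1)] bounded_linear_compose[OF bl(2)])
qed

lemma norm_l1_inl_le: "norm (\<phi> o\<^sub>L l1_inl) \<le> norm \<phi>"
proof (rule norm_blinfun_bound)
  show "norm ((\<phi> o\<^sub>L l1_inl) a) \<le> norm \<phi> * norm a" for a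
    using norm_blinfun[of \<phi> "L1_Pair a 0"] by (simp add: l1_inl.rep_eq norm_l1_sum_def)
qed simp

lemma norm_l1_inr_le: "norm (\<phi> o\<^sub>L l1_inr) \<le> norm \<phi>"
proof (rule norm_blinfun_bound)
  show "norm ((\<phi> o\<^sub>L l1_inr) b) \<le> norm \<phi> * norm b" for b
    using norm_blinfun[of \<phi> "L1_Pair 0 b"] by (simp add: l1_inr.rep_eq norm_l1_sum_def)
qed simp

text \<open>The dual of the l1-norm is the maximum norm; this is why the unit ball of the dual is
  the product of the two dual balls.\<close>

lemma norm_l1_case_le:
  assumes "norm s \<le> c" "norm t \<le> c"
  shows "norm (l1_case s t) \<le> c"
proof (rule norm_blinfun_bound)
  show "0 \<le> c"
    using norm_ge_zero assms(1) by (rule order_trans)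
  fix x
  have "norm (blinfun_apply s (l1_fst x)) \<le> c * norm (l1_fst x)" "norm (blinfun_apply t (l1_snd x)) \<le> c * norm (l1_snd x)"
    using norm_blinfun[of s] norm_blinfun[of t] assms mult_right_mono[OF _ norm_ge_zero] order_trans by blast+
  then show "norm (l1_case s t x) \<le> c * norm x"
    by (simp add: l1_case.rep_eq norm_l1_sum_def distrib_left)
qed

lemma l1_case_inl [simp]: "l1_case s t o\<^sub>L l1_inl = s"
  by (rule blinfun_eqI) (simp add: l1_case.rep_eq l1_inl.rep_eq)

lemma l1_case_inr [simp]: "l1_case s t o\<^sub>L l1_inr = t"
  by (rule blinfun_eqI) (simp add: l1_case.rep_eq l1_inr.rep_eq)

lemma l1_case_eta [simp]: "l1_case (\<phi> o\<^sub>L l1_inl) (\<phi> o\<^sub>L l1_inr) = \<phi>"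
proof (rule blinfun_eqI)
  fix x
  have "blinfun_apply \<phi> (L1_Pair (l1_fst x) 0 + L1_Pair 0 (l1_snd x)) = blinfun_apply \<phi> x"
    by (rule arg_cong[where f = "blinfun_apply \<phi>"]) (simp add: l1_sum_eq_iff)
  then show "blinfun_apply (l1_case (\<phi> o\<^sub>L l1_inl) (\<phi> o\<^sub>L l1_inr)) x = blinfun_apply \<phi> x"
    by (simp add: l1_case.rep_eq l1_inl.rep_eq l1_inr.rep_eq blinfun.add_right)
qed

text \<open>At each \<open>x\<close> the lifted functional is a sum of two evaluations, one after
  \<open>g\<close> and one of \<open>\<phi>\<close> itself, both weak-star continuous. The ball is
  preserved because both components keep norm at most 1.\<close>

lemma continuous_map_l1_lift:
  fixes g :: "('a::real_normed_vector \<Rightarrow>\<^sub>L real) \<Rightarrow> 'a \<Rightarrow>\<^sub>L real"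
  assumes g: "continuous_map weak_star_ball weak_star_ball g"
  shows "continuous_map weak_star_ball weak_star_ball
    (\<lambda>\<phi> :: ('a, 'b::real_normed_vector) l1_sum \<Rightarrow>\<^sub>L real. l1_case (g (\<phi> o\<^sub>L l1_inl)) (\<phi> o\<^sub>L l1_inr))"
  unfolding continuous_map_in_subtopology[of _ _ "cball 0 1"]
proof
  have inl: "continuous_map weak_star_ball weak_star_ball (\<lambda>\<phi> :: ('a, 'b) l1_sum \<Rightarrow>\<^sub>L real. \<phi> o\<^sub>L l1_inl)"
    unfolding continuous_map_in_subtopology[of _ _ "cball 0 1"]
      continuous_on_strong_operator_topo_iff_coordinatewise
  proof (intro conjI allI)
    show "continuous_map weak_star_ball euclidean
        (\<lambda>\<phi> :: ('a, 'b) l1_sum \<Rightarrow>\<^sub>L real. blinfun_apply (\<phi> o\<^sub>L l1_inl) a)" for a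
      using continuous_map_weak_star_ball_eval by simp
    show "(\<lambda>\<phi> :: ('a, 'b) l1_sum \<Rightarrow>\<^sub>L real. \<phi> o\<^sub>L l1_inl) \<in> topspace weak_star_ball \<rightarrow> cball 0 1"
      using order_trans[OF norm_l1_inl_le] by (auto simp: topspace_weak_star_ball)
  qed
  have ball: "norm (g s) \<le> 1" if "norm s \<le> 1" for s
    using continuous_map_funspace[OF g] that unfolding topspace_weak_star_ball by auto
  show "continuous_map weak_star_ball weak_star_topology
      (\<lambda>\<phi> :: ('a, 'b) l1_sum \<Rightarrow>\<^sub>L real. l1_case (g (\<phi> o\<^sub>L l1_inl)) (\<phi> o\<^sub>L l1_inr))"
    unfolding continuous_on_strong_operator_topo_iff_coordinatewise
  proof
    fix x :: "('a, 'b) l1_sum"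
    have "continuous_map weak_star_ball euclidean
        (\<lambda>\<phi> :: ('a, 'b) l1_sum \<Rightarrow>\<^sub>L real. blinfun_apply (g (\<phi> o\<^sub>L l1_inl)) (l1_fst x))"
      using continuous_map_compose[OF continuous_map_compose[OF inl g] continuous_map_weak_star_ball_eval]
      by (simp add: o_def)
    then have "continuous_map weak_star_ball euclidean
        (\<lambda>\<phi>. blinfun_apply (g (\<phi> o\<^sub>L l1_inl)) (l1_fst x) + blinfun_apply \<phi> (l1_inr (l1_snd x)))"
      by (intro continuous_map_add continuous_map_weak_star_ball_eval)
    then show "continuous_map weak_star_ball euclidean
        (\<lambda>\<phi>. blinfun_apply (l1_case (g (\<phi> o\<^sub>L l1_inl)) (\<phi> o\<^sub>L l1_inr)) x)"
      by (simp add: l1_case.rep_eq)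
  qed
  have "norm (l1_case (g (\<phi> o\<^sub>L l1_inl)) (\<phi> o\<^sub>L l1_inr)) \<le> 1" if "norm \<phi> \<le> 1"
    for \<phi> :: "('a, 'b) l1_sum \<Rightarrow>\<^sub>L real"
    using norm_l1_inl_le[of \<phi>] norm_l1_inr_le[of \<phi>] that by (intro norm_l1_case_le ball) auto
  then show "(\<lambda>\<phi> :: ('a, 'b) l1_sum \<Rightarrow>\<^sub>L real. l1_case (g (\<phi> o\<^sub>L l1_inl)) (\<phi> o\<^sub>L l1_inr))
      \<in> topspace weak_star_ball \<rightarrow> cball 0 1"
    by (auto simp: topspace_weak_star_ball)
qed

text \<open>Apply the wild map to the \<open>S\<close>-component of a functional and the identity to
  its \<open>Y\<close>-component. The result fixes 0 and is not norm continuous there.\<close>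

theorem proposition5:
  assumes S_inf_dim: "\<not> (\<exists>B :: 's::banach set. finite B \<and> span B = UNIV)"
    and S_separable: "separable_space (euclidean :: 's topology)"
    and Y_nonseparable: "\<not> separable_space (euclidean :: 'y::banach topology)"
  shows "\<exists>f :: (('s, 'y) l1_sum \<Rightarrow>\<^sub>L real) \<Rightarrow> (('s, 'y) l1_sum \<Rightarrow>\<^sub>L real).
    homeomorphic_map weak_star_ball weak_star_ball f \<and> \<not> continuous_on (cball 0 1) f"
proof -
  obtain g g' :: "('s \<Rightarrow>\<^sub>L real) \<Rightarrow> 's \<Rightarrow>\<^sub>L real"
    where g: "homeomorphic_maps weak_star_ball weak_star_ball g g'" and g0: "g 0 = 0"
      and wild: "\<And>\<epsilon>. 0 < \<epsilon> \<Longrightarrow> \<exists>s. norm s \<le> 1 \<and> norm s \<le> \<epsilon> \<and> 1/4 < norm (g s)"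
    using ex_wild_dual_ball_homeomorphism[OF S_inf_dim S_separable] by blast
  define lift where "lift h \<phi> = l1_case (h (\<phi> o\<^sub>L l1_inl)) (\<phi> o\<^sub>L l1_inr)"
    for h :: "('s \<Rightarrow>\<^sub>L real) \<Rightarrow> 's \<Rightarrow>\<^sub>L real" and \<phi> :: "('s, 'y) l1_sum \<Rightarrow>\<^sub>L real"
  have inv: "g' (g s) = s" "g (g' s) = s" if "norm s \<le> 1" for s
    using g that unfolding homeomorphic_maps_def topspace_weak_star_ball by auto
  have "norm (\<phi> o\<^sub>L l1_inl) \<le> 1" if "norm \<phi> \<le> 1" for \<phi> :: "('s, 'y) l1_sum \<Rightarrow>\<^sub>L real"
    using norm_l1_inl_le[of \<phi>] that by simp
  then have "homeomorphic_maps weak_star_ball weak_star_ball (lift g) (lift g')"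
    using g unfolding homeomorphic_maps_def topspace_weak_star_ball lift_def
    by (auto intro!: continuous_map_l1_lift simp: inv)
  then have "homeomorphic_map weak_star_ball weak_star_ball (lift g)"
    by (auto simp: homeomorphic_map_maps)
  moreover have "\<not> continuous_on (cball 0 1) (lift g)"
  proof
    assume "continuous_on (cball 0 1) (lift g)"
    then obtain \<delta> where "0 < \<delta>"
      and "\<forall>\<phi>\<in>cball 0 1. dist \<phi> 0 < \<delta> \<longrightarrow> dist (lift g \<phi>) (lift g 0) < 1/4"
      unfolding continuous_on_iff by (metis centre_in_cball zero_le_one zero_less_divide_1_iff zero_less_numeral)
    moreover have "lift g 0 = 0"
      by (rule blinfun_eqI) (simp add: lift_def g0 l1_case.rep_eq)
    ultimately have \<delta>: "0 < \<delta>" "\<And>\<phi>. norm \<phi> \<le> 1 \<Longrightarrow> norm \<phi> < \<delta> \<Longrightarrow> norm (lift g \<phi>) < 1/4"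
      by simp_all
    obtain s where s: "norm s \<le> 1" "norm s \<le> \<delta> / 2" "1/4 < norm (g s)"
      using wild[of "\<delta> / 2"] \<delta>(1) by auto
    \<comment> \<open>Extending \<open>s\<close> by 0 keeps the norm below \<open>\<delta>\<close>,
      while the restriction of \<open>lift g \<phi>\<close> to the first summand is
      \<open>g s\<close>, and restriction does not increase the norm.\<close>
    define \<phi> :: "('s, 'y) l1_sum \<Rightarrow>\<^sub>L real" where "\<phi> = l1_case s 0"
    have "norm \<phi> \<le> norm s"
      unfolding \<phi>_def by (rule norm_l1_case_le) auto
    then have "norm (lift g \<phi>) < 1/4"
      using s \<delta> by (intro \<delta>(2)) auto
    moreover have "lift g \<phi> o\<^sub>L l1_inl = g s"
      by (simp add: lift_def \<phi>_def)
    ultimately show False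
      using norm_l1_inl_le[of "lift g \<phi>"] s(3) by simp
  qed
  ultimately show ?thesis
    by blast
qed

end
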